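(* Let $G$ be a finite group and let $\overline{L}(G)$ be the poset of conjugacy classes of subgroups of $G$. Then $\overline{L}(G)$ possesses a breaking point if and only if $G$ is either a cyclic $p$-group of order at least $p^2$ for some prime $p$, or a generalized quaternion $2$-group.
   Context: For a finite group $G$ and a subgroup $H\leq G$, let $[H]=\{H^x \mid x\in G\}$ be the conjugacy class of $H$, and let $\overline{L}(G)=\{[H]\mid H\leq G\}$, partially ordered by $[H_1]\leq [H_2]$ if and only if $H_1\subseteq H_2^x$ for some $x\in G$. Its least element is $[1]$ and its greatest element is $[G]$. A breaking point of $\overline{L}(G)$ is an element $[H]\in\overline{L}(G)$ with $1\neq H\neq G$ such that for every $[X]\in\overline{L}(G)$ we have either $[X]\leq [H]$ or $[H]\leq [X]$. The generalized quaternion $2$-groups are the groups $Q_{2^n}=\langle a,b \mid a^{2^{n-2}}= b^2,\ a^{2^{n-1}}=1,\ b^{-1}ab=a^{-1}\rangle$ with $n\geq 3$. *)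

theory Defs
  imports "HOL-Algebra.Elementary_Groups" "HOL-Computational_Algebra.Primes"
begin

definition conj_subgroup :: "('a, 'b) monoid_scheme \<Rightarrow> 'a set \<Rightarrow> 'a \<Rightarrow> 'a set"
  where "conj_subgroup G H x = (\<lambda>h. inv\<^bsub>G\<^esub> x \<otimes>\<^bsub>G\<^esub> h \<otimes>\<^bsub>G\<^esub> x) ` H"

definition subgroup_conj_class :: "('a, 'b) monoid_scheme \<Rightarrow> 'a set \<Rightarrow> 'a set set"
  where "subgroup_conj_class G H = conj_subgroup G H ` carrier G"

definition subgroup_class_poset :: "('a, 'b) monoid_scheme \<Rightarrow> 'a set set gorder"
  where "subgroup_class_poset G =
    \<lparr> carrier = {subgroup_conj_class G H | H. subgroup H G},
      eq = (=),
      le = (\<lambda>C D. \<exists>H1 H2. subgroup H1 G \<and> subgroup H2 G \<and>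
              C = subgroup_conj_class G H1 \<and> D = subgroup_conj_class G H2 \<and>
              (\<exists>x \<in> carrier G. H1 \<subseteq> conj_subgroup G H2 x)) \<rparr>"

definition breaking_point :: "('a, 'b) monoid_scheme \<Rightarrow> 'a set set \<Rightarrow> bool"
  where "breaking_point G C \<longleftrightarrow>
    (\<exists>H. subgroup H G \<and> C = subgroup_conj_class G H \<and> H \<noteq> {\<one>\<^bsub>G\<^esub>} \<and> H \<noteq> carrier G) \<and>
    (\<forall>X \<in> carrier (subgroup_class_poset G).
       X \<sqsubseteq>\<^bsub>subgroup_class_poset G\<^esub> C \<or> C \<sqsubseteq>\<^bsub>subgroup_class_poset G\<^esub> X)"

text \<open>
  A letter \<open>(g, True)\<close> stands for the generator \<open>g\<close>, and \<open>(g, False)\<close> for its formal inverse.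
  A relation \<open>u = v\<close> is the pair \<open>(u, v)\<close> of words. The group presented by \<open>R\<close>, whose generators
  are all elements of the type \<open>'g\<close>, is the quotient of the monoid of words by the congruence
  generated by free cancellation together with \<open>R\<close>.
\<close>

type_synonym 'g word = "('g \<times> bool) list"

inductive pres_cong :: "('g word \<times> 'g word) set \<Rightarrow> 'g word \<Rightarrow> 'g word \<Rightarrow> bool"
  for R :: "('g word \<times> 'g word) set"
where
  refl: "pres_cong R u u"
| sym: "pres_cong R u v \<Longrightarrow> pres_cong R v u"
| trans: "pres_cong R u v \<Longrightarrow> pres_cong R v w \<Longrightarrow> pres_cong R u w"
| cancel: "pres_cong R (u @ [(g, e), (g, \<not> e)] @ v) (u @ v)"
| rel: "(r, s) \<in> R \<Longrightarrow> pres_cong R (u @ r @ v) (u @ s @ v)"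

definition pres_class :: "('g word \<times> 'g word) set \<Rightarrow> 'g word \<Rightarrow> 'g word set"
  where "pres_class R u = {v. pres_cong R u v}"

definition presented_group :: "('g word \<times> 'g word) set \<Rightarrow> 'g word set monoid"
  where "presented_group R =
    \<lparr> carrier = range (pres_class R),
      monoid.mult = (\<lambda>A B. \<Union>u \<in> A. \<Union>v \<in> B. pres_class R (u @ v)),
      one = pres_class R [] \<rparr>"

datatype quat_gen = Gen_a | Gen_b

definition gen_quaternion_group :: "nat \<Rightarrow> quat_gen word set monoid"
  where "gen_quaternion_group n = presented_group
    {(replicate (2 ^ (n - 2)) (Gen_a, True), replicate 2 (Gen_b, True)),
     (replicate (2 ^ (n - 1)) (Gen_a, True), []),
     ([(Gen_b, False), (Gen_a, True), (Gen_b, True)], [(Gen_a, False)])}"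

definition is_gen_quaternion :: "('a, 'b) monoid_scheme \<Rightarrow> bool"
  where "is_gen_quaternion G \<longleftrightarrow> (\<exists>n \<ge> 3. G \<cong> gen_quaternion_group n)"

lemma conj_subgroup_one:
  assumes "group G" "H \<subseteq> carrier G"
  shows "conj_subgroup G H \<one>\<^bsub>G\<^esub> = H"
proof -
  interpret group G by fact
  have "(\<lambda>h. inv\<^bsub>G\<^esub> \<one>\<^bsub>G\<^esub> \<otimes>\<^bsub>G\<^esub> h \<otimes>\<^bsub>G\<^esub> \<one>\<^bsub>G\<^esub>) ` H = id ` H"
    using assms(2) by (intro image_cong) auto
  then show ?thesis by (simp add: conj_subgroup_def)
qed

lemma conj_subgroup_mult:
  assumes "group G" "H \<subseteq> carrier G" "x \<in> carrier G" "y \<in> carrier G"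
  shows "conj_subgroup G (conj_subgroup G H x) y = conj_subgroup G H (x \<otimes>\<^bsub>G\<^esub> y)"
proof -
  interpret group G by fact
  show ?thesis
    unfolding conj_subgroup_def image_image
    using assms(2-4) by (intro image_cong) (auto simp: m_assoc inv_mult_group subset_iff)
qed

lemma conj_subgroup_closed:
  assumes "group G" "H \<subseteq> carrier G" "x \<in> carrier G"
  shows "conj_subgroup G H x \<subseteq> carrier G"
proof -
  interpret group G by fact
  show ?thesis using assms(2,3) by (auto simp: conj_subgroup_def)
qed

lemma conj_subgroup_mono: "H \<subseteq> K \<Longrightarrow> conj_subgroup G H x \<subseteq> conj_subgroup G K x"
  by (auto simp: conj_subgroup_def)

lemma card_conj_subgroup:
  assumes "group G" "H \<subseteq> carrier G" "x \<in> carrier G"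
  shows "card (conj_subgroup G H x) = card H"
proof -
  interpret group G by fact
  have "inj_on (\<lambda>h. inv\<^bsub>G\<^esub> x \<otimes>\<^bsub>G\<^esub> h \<otimes>\<^bsub>G\<^esub> x) H"
    using assms(2,3) by (auto intro!: inj_onI simp: subset_iff)
  then show ?thesis by (simp add: conj_subgroup_def card_image)
qed

lemma subgroup_conj_class_conj:
  assumes "group G" "H \<subseteq> carrier G" "x \<in> carrier G"
  shows "subgroup_conj_class G (conj_subgroup G H x) = subgroup_conj_class G H"
proof -
  interpret group G by fact
  have *: "conj_subgroup G H y = conj_subgroup G (conj_subgroup G H x) (inv\<^bsub>G\<^esub> x \<otimes>\<^bsub>G\<^esub> y)"
    if "y \<in> carrier G" for y
    using that assms by (simp add: conj_subgroup_mult m_assoc[symmetric])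
  show ?thesis
  proof (intro equalityI subsetI, unfold subgroup_conj_class_def)
    fix K assume "K \<in> conj_subgroup G (conj_subgroup G H x) ` carrier G"
    then show "K \<in> conj_subgroup G H ` carrier G"
      using conj_subgroup_mult[OF assms] assms(3) m_closed by auto
  next
    fix K assume "K \<in> conj_subgroup G H ` carrier G"
    then obtain y where y: "y \<in> carrier G" "K = conj_subgroup G H y" by blast
    have "K = conj_subgroup G (conj_subgroup G H x) (inv\<^bsub>G\<^esub> x \<otimes>\<^bsub>G\<^esub> y)"
      unfolding y(2) using y(1) by (rule *)
    then show "K \<in> conj_subgroup G (conj_subgroup G H x) ` carrier G"
      by (rule image_eqI) (use y(1) assms(3) in simp)
  qed
qed

lemma subgroup_conj_class_eqD:
  assumes "group G" "H \<subseteq> carrier G" "subgroup_conj_class G H = subgroup_conj_class G K"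
  obtains x where "x \<in> carrier G" "H = conj_subgroup G K x"
proof -
  interpret group G by fact
  have "H \<in> subgroup_conj_class G H"
    using conj_subgroup_one[OF assms(1,2)] by (force simp: subgroup_conj_class_def)
  then show ?thesis using assms(3) that by (auto simp: subgroup_conj_class_def)
qed

lemma le_subgroup_class_poset_iff:
  assumes "group G" "subgroup H G" "subgroup K G"
  shows "subgroup_conj_class G H \<sqsubseteq>\<^bsub>subgroup_class_poset G\<^esub> subgroup_conj_class G K
    \<longleftrightarrow> (\<exists>x \<in> carrier G. H \<subseteq> conj_subgroup G K x)" (is "?L \<longleftrightarrow> ?R")
proof
  interpret group G by fact
  assume ?L
  then obtain H1 K1 x where h: "subgroup H1 G" "subgroup K1 G"
    "subgroup_conj_class G H = subgroup_conj_class G H1"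
    "subgroup_conj_class G K = subgroup_conj_class G K1"
    "x \<in> carrier G" "H1 \<subseteq> conj_subgroup G K1 x"
    by (auto simp: subgroup_class_poset_def)
  obtain y where y: "y \<in> carrier G" "H = conj_subgroup G H1 y"
    using subgroup_conj_class_eqD[OF assms(1) subgroup.subset[OF assms(2)] h(3)] .
  obtain z where z: "z \<in> carrier G" "K1 = conj_subgroup G K z"
    using subgroup_conj_class_eqD[OF assms(1) subgroup.subset[OF h(2)] h(4)[symmetric]] .
  have K: "K \<subseteq> carrier G" using assms(3) by (rule subgroup.subset)
  have "H \<subseteq> conj_subgroup G (conj_subgroup G (conj_subgroup G K z) x) y"
    using conj_subgroup_mono[OF h(6), of G y] y(2) z(2) by simp
  also have "\<dots> = conj_subgroup G K (z \<otimes>\<^bsub>G\<^esub> x \<otimes>\<^bsub>G\<^esub> y)"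
    using K y(1) z(1) h(5) by (simp add: conj_subgroup_mult)
  finally show ?R using y(1) z(1) h(5) by blast
next
  assume ?R
  then show ?L using assms by (auto simp: subgroup_class_poset_def)
qed

lemma partial_order_subgroup_class_poset:
  assumes "group G" "finite (carrier G)"
  shows "partial_order (subgroup_class_poset G)"
proof -
  interpret group G by fact
  let ?L = "subgroup_class_poset G"
  have car: "carrier ?L = {subgroup_conj_class G H | H. subgroup H G}" and eq: "eq ?L = (=)"
    by (simp_all add: subgroup_class_poset_def)
  note le = le_subgroup_class_poset_iff[OF assms(1)]
  show ?thesis
  proof (unfold_locales, unfold eq car)
    fix C assume "C \<in> {subgroup_conj_class G H | H. subgroup H G}"
    then obtain H where H: "subgroup H G" "C = subgroup_conj_class G H" by auto
    have "H \<subseteq> conj_subgroup G H \<one>\<^bsub>G\<^esub>"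
      using conj_subgroup_one[OF assms(1) subgroup.subset[OF H(1)]] by simp
    then show "C \<sqsubseteq>\<^bsub>?L\<^esub> C" using le[OF H(1) H(1)] H(2) by auto
  next
    fix C D assume CD: "C \<sqsubseteq>\<^bsub>?L\<^esub> D" "D \<sqsubseteq>\<^bsub>?L\<^esub> C"
      and "C \<in> {subgroup_conj_class G H | H. subgroup H G}"
          "D \<in> {subgroup_conj_class G H | H. subgroup H G}"
    then obtain H K where HK: "subgroup H G" "subgroup K G"
      "C = subgroup_conj_class G H" "D = subgroup_conj_class G K" by auto
    have sub: "H \<subseteq> carrier G" "K \<subseteq> carrier G" using HK subgroup.subset by auto
    obtain x y where xy: "x \<in> carrier G" "y \<in> carrier G"
      "H \<subseteq> conj_subgroup G K x" "K \<subseteq> conj_subgroup G H y"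
      using CD le[OF HK(1,2)] le[OF HK(2,1)] unfolding HK(3,4) by blast
    have fin: "finite (conj_subgroup G K x)" "finite (conj_subgroup G H y)"
      using sub assms(2) by (auto simp: conj_subgroup_def intro: finite_subset)
    have "card K \<le> card H"
      using card_mono[OF fin(2) xy(4)] card_conj_subgroup[OF assms(1) sub(1) xy(2)] by simp
    then have "H = conj_subgroup G K x"
      using card_seteq[OF fin(1) xy(3)] card_conj_subgroup[OF assms(1) sub(2) xy(1)] by simp
    then show "C = D"
      using subgroup_conj_class_conj[OF assms(1) sub(2) xy(1)] HK by simp
  next
    fix C D E assume CD: "C \<sqsubseteq>\<^bsub>?L\<^esub> D" "D \<sqsubseteq>\<^bsub>?L\<^esub> E"
      and "C \<in> {subgroup_conj_class G H | H. subgroup H G}"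
          "D \<in> {subgroup_conj_class G H | H. subgroup H G}"
          "E \<in> {subgroup_conj_class G H | H. subgroup H G}"
    then obtain H K M where HK: "subgroup H G" "subgroup K G" "subgroup M G"
      "C = subgroup_conj_class G H" "D = subgroup_conj_class G K" "E = subgroup_conj_class G M"
      by auto
    obtain x y where xy: "x \<in> carrier G" "y \<in> carrier G"
      "H \<subseteq> conj_subgroup G K x" "K \<subseteq> conj_subgroup G M y"
      using CD le[OF HK(1,2)] le[OF HK(2,3)] unfolding HK(4-6) by blast
    have "H \<subseteq> conj_subgroup G (conj_subgroup G M y) x"
      using xy(3) conj_subgroup_mono[OF xy(4)] by blast
    then have "H \<subseteq> conj_subgroup G M (y \<otimes>\<^bsub>G\<^esub> x)"
      using xy(1,2) HK(3) by (simp add: conj_subgroup_mult subgroup.subset)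
    then show "C \<sqsubseteq>\<^bsub>?L\<^esub> E" using xy(1,2) le[OF HK(1,3)] unfolding HK(4,6) by blast
  qed auto
qed

lemma pres_cong_append:
  assumes "pres_cong R u u'" "pres_cong R v v'"
  shows "pres_cong R (u @ v) (u' @ v')"
proof -
  have left: "pres_cong R (w @ x) (w @ y)" if "pres_cong R x y" for w x y
    using that
  proof induction
    case (cancel u g e v) then show ?case using pres_cong.cancel[of R "w @ u" g e v] by simp
  next
    case (rel r s u v) then show ?case using pres_cong.rel[of r s R "w @ u" v] by simp
  qed (blast intro: pres_cong.intros)+
  have right: "pres_cong R (x @ w) (y @ w)" if "pres_cong R x y" for w x y
    using that
  proof induction
    case (cancel u g e v) then show ?case using pres_cong.cancel[of R u g e "v @ w"] by simp
  next
    case (rel r s u v) then show ?case using pres_cong.rel[of r s R u "v @ w"] by simp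
  qed (blast intro: pres_cong.intros)+
  show ?thesis using left[OF assms(2)] right[OF assms(1)] pres_cong.trans by blast
qed

lemma pres_class_eq_iff: "pres_class R u = pres_class R v \<longleftrightarrow> pres_cong R u v"
  unfolding pres_class_def set_eq_iff mem_Collect_eq
  by (meson pres_cong.refl pres_cong.sym pres_cong.trans)

lemma mult_pres_class:
  "pres_class R u \<otimes>\<^bsub>presented_group R\<^esub> pres_class R v = pres_class R (u @ v)"
proof -
  have "pres_class R (u' @ v') = pres_class R (u @ v)"
    if "pres_cong R u u'" "pres_cong R v v'" for u' v'
    using that pres_cong_append pres_class_eq_iff pres_cong.sym by metis
  moreover have "pres_cong R u u" "pres_cong R v v" by (auto intro: pres_cong.refl)
  ultimately have "(\<Union>u' \<in> pres_class R u. \<Union>v' \<in> pres_class R v. pres_class R (u' @ v'))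
      = pres_class R (u @ v)"
    unfolding pres_class_def[of R u] pres_class_def[of R v] by blast
  then show ?thesis by (simp add: presented_group_def)
qed

lemma pres_cong_inverse: "pres_cong R (rev (map (\<lambda>(g, e). (g, \<not> e)) u) @ u) []"
proof (induction u)
  case (Cons l u)
  obtain g e where l: "l = (g, e)" by (cases l)
  have "pres_cong R (rev (map (\<lambda>(g, e). (g, \<not> e)) u) @ [(g, \<not> e), (g, \<not> \<not> e)] @ u)
          (rev (map (\<lambda>(g, e). (g, \<not> e)) u) @ u)"
    by (rule pres_cong.cancel)
  then show ?case using Cons pres_cong.trans by (fastforce simp: l)
qed (simp add: pres_cong.refl)

lemma group_presented_group: "group (presented_group R)"
proof (rule groupI)
  show "\<exists>y \<in> carrier (presented_group R).
      y \<otimes>\<^bsub>presented_group R\<^esub> x = \<one>\<^bsub>presented_group R\<^esub>" if x: "x \<in> carrier (presented_group R)" for x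
  proof -
    obtain u where u: "x = pres_class R u" using x by (auto simp: presented_group_def)
    let ?y = "pres_class R (rev (map (\<lambda>(g, e). (g, \<not> e)) u))"
    have "?y \<otimes>\<^bsub>presented_group R\<^esub> x = pres_class R []"
      unfolding u mult_pres_class pres_class_eq_iff by (rule pres_cong_inverse)
    then show ?thesis
      by (intro bexI[where x = ?y]) (simp, simp_all add: presented_group_def)
  qed
next
  have car: "carrier (presented_group R) = range (pres_class R)"
    and one: "\<one>\<^bsub>presented_group R\<^esub> = pres_class R []" by (simp_all add: presented_group_def)
  show "\<one>\<^bsub>presented_group R\<^esub> \<in> carrier (presented_group R)" by (simp add: car one)
  show "x \<otimes>\<^bsub>presented_group R\<^esub> y \<in> carrier (presented_group R)"
    if "x \<in> carrier (presented_group R)" "y \<in> carrier (presented_group R)" for x y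
    using that by (auto simp: car mult_pres_class)
  show "x \<otimes>\<^bsub>presented_group R\<^esub> y \<otimes>\<^bsub>presented_group R\<^esub> z =
      x \<otimes>\<^bsub>presented_group R\<^esub> (y \<otimes>\<^bsub>presented_group R\<^esub> z)"
    if "x \<in> carrier (presented_group R)" "y \<in> carrier (presented_group R)"
       "z \<in> carrier (presented_group R)" for x y z
    using that by (auto simp: car mult_pres_class)
  show "\<one>\<^bsub>presented_group R\<^esub> \<otimes>\<^bsub>presented_group R\<^esub> x = x"
    if "x \<in> carrier (presented_group R)" for x
    using that by (auto simp: car one mult_pres_class)
qed

end

theory Submission
  imports Defs Complex_Main "HOL-Algebra.Group_Action" "HOL-Algebra.Sylow"
    "HOL-Number_Theory.Residues"
begin

text \<open>
  Let \<open>[H]\<close> be a breaking point. Comparing \<open>H\<close> with the Sylow subgroups shows that \<open>G\<close> is a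
  \<open>p\<close>-group. The conjugates of the proper subgroup \<open>H\<close> do not cover \<open>G\<close>, so some cyclic subgroup
  lies in no conjugate of \<open>H\<close> and hence contains one; thus \<open>H\<close> is cyclic. It follows that all subgroups of
  order \<open>p\<close> are conjugate, and as one of them is central, there is only one. In such a group a maximal
  abelian normal subgroup \<open>A\<close> is cyclic and its own centralizer. If \<open>p\<close> is odd, an element
  \<open>b \<notin> A\<close> with \<open>b\<^sup>p \<in> A\<close> could be altered by an element of \<open>A\<close> to have order \<open>p\<close>, so \<open>G = A\<close>.
  If \<open>p = 2\<close>, every such \<open>b\<close> inverts \<open>A\<close>, so \<open>A\<close> has index at most \<open>2\<close> and \<open>G\<close> is cyclic or
  generalized quaternion. Conversely, in these groups some element of prime order lies in every
  nontrivial subgroup, and the subgroup it generates yields a breaking point.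
\<close>

section \<open>Finite groups of prime power order\<close>

text \<open>The case analysis over the cyclic subgroup \<open>A\<close> rests on one formula: if
  \<open>b a = a^r b\<close>, then \<open>(a^i b)^p = a^(i (1 + r + ... + r^(p-1))) b^p\<close>.
  Finding an element of order \<open>p\<close> outside \<open>A\<close> thus means solving a linear
  congruence in \<open>i\<close>, which is possible once the geometric sum is \<open>p\<close> times
  a number prime to \<open>p\<close>. For odd \<open>p\<close> this always holds. For
  \<open>p = 2\<close> the sum is \<open>1 + r\<close>, and it fails exactly when \<open>r\<close>
  is 3 modulo 4; this is the gap in which the quaternion groups live. As those groups are given by
  generators and relations, the presented group might be too large or might collapse. Normal forms
  \<open>a^i b^s\<close> bound its order by \<open>2^n\<close>, so a surjection onto a group of
  order \<open>2^n\<close> is an isomorphism. A representation on pairs of complex numbers keeps 1,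
  \<open>b\<close> and \<open>b^2\<close> distinct, which makes the subgroup generated by
  \<open>b^2\<close> nontrivial and proper.\<close>

lemma (in group) generate_finite:
  assumes "finite (carrier G)" "a \<in> carrier G"
  shows "generate G {a} = range (\<lambda>k::nat. a [^] k)"
  using generate_pow_on_finite_carrier[OF assms] by auto

lemma (in group) pow_mem_subgroup:
  assumes "subgroup H G" "x \<in> H"
  shows "x [^] (k::nat) \<in> H"
  by (induction k) (auto simp: assms subgroup.one_closed subgroup.m_closed)

lemma (in group) commute_inv:
  assumes "x \<in> carrier G" "y \<in> carrier G" "x \<otimes> y = y \<otimes> x"
  shows "inv x \<otimes> y = y \<otimes> inv x"
proof -
  have "inv x \<otimes> (x \<otimes> y) \<otimes> inv x = inv x \<otimes> (y \<otimes> x) \<otimes> inv x" using assms(3) by simp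
  moreover have "inv x \<otimes> (x \<otimes> y) \<otimes> inv x = y \<otimes> inv x"
    using assms(1,2) by (simp add: m_assoc[symmetric])
  moreover have "inv x \<otimes> (y \<otimes> x) \<otimes> inv x = inv x \<otimes> y"
    using assms(1,2) by (simp add: m_assoc)
  ultimately show ?thesis by simp
qed

lemma (in group) commute_mult:
  assumes "x \<in> carrier G" "y \<in> carrier G" "w \<in> carrier G" "x \<otimes> w = w \<otimes> x" "y \<otimes> w = w \<otimes> y"
  shows "x \<otimes> y \<otimes> w = w \<otimes> (x \<otimes> y)"
  using assms by (metis m_assoc)

lemma (in group) card_subgroup_dvd:
  assumes "subgroup H G" "subgroup K G" "H \<subseteq> K"
  shows "card H dvd card K"
proof -
  interpret K: group "G\<lparr>carrier := K\<rparr>"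
    using assms(2) by (rule subgroup_imp_group)
  have "subgroup H (G\<lparr>carrier := K\<rparr>)"
    using assms by (simp add: subgroup_incl)
  from K.lagrange[OF this] show ?thesis
    by (simp add: order_def) (metis dvd_triv_right)
qed

lemma (in group) subgroup_eq_one_iff:
  assumes "finite (carrier G)" "subgroup H G"
  shows "H = {\<one>} \<longleftrightarrow> card H = 1"
  using subgroup.one_closed[OF assms(2)] by (auto simp: card_1_singleton_iff)

text \<open>Orbit sizes are powers of \<open>p\<close>, so orbits without fixed points have size
  divisible by \<open>p\<close>. The known fixed point \<open>x0\<close> contributes 1 to a total
  divisible by \<open>p\<close>, hence some other orbit is a singleton as well.\<close>

lemma (in group_action) fixed_point_of_prime_power_order:
  assumes "finite (carrier G)" "prime p" "order G = p ^ k"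
    and S: "S \<subseteq> E" "finite S" "p dvd card S"
    and inv: "\<And>g x. g \<in> carrier G \<Longrightarrow> x \<in> S \<Longrightarrow> \<phi> g x \<in> S"
    and x0: "x0 \<in> S" "\<And>g. g \<in> carrier G \<Longrightarrow> \<phi> g x0 = x0"
  shows "\<exists>x \<in> S. x \<noteq> x0 \<and> (\<forall>g \<in> carrier G. \<phi> g x = x)"
proof (rule ccontr)
  assume no: "\<not> ?thesis"
  interpret group G using group_hom group_hom.axioms(1) by auto
  let ?O = "orbit G \<phi> ` S"
  have sub: "orbit G \<phi> x \<subseteq> S" if "x \<in> S" for x
    using inv that by (auto simp: orbit_def)
  have refl: "x \<in> orbit G \<phi> x" if "x \<in> S" for x
    using that S(1) orbit_refl by blast
  have orb: "orbit G \<phi> x = orbit G \<phi> y" if "x \<in> S" "y \<in> S" "z \<in> orbit G \<phi> x" "z \<in> orbit G \<phi> y" for x y z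
  proof -
    have "z \<in> S" using sub that by blast
    with that S(1) have E: "x \<in> E" "y \<in> E" "z \<in> E" by auto
    have *: "w \<in> E" if "w \<in> orbit G \<phi> x \<or> w \<in> orbit G \<phi> y" for w
      using that sub \<open>x \<in> S\<close> \<open>y \<in> S\<close> S(1) by blast
    show ?thesis
    proof (intro equalityI subsetI)
      fix w assume "w \<in> orbit G \<phi> x"
      then show "w \<in> orbit G \<phi> y"
        using orbit_trans[OF E(2,3)] orbit_trans[OF E(3,1)] orbit_sym[OF E(1,3)] * that E by meson
    next
      fix w assume "w \<in> orbit G \<phi> y"
      then show "w \<in> orbit G \<phi> x"
        using orbit_trans[OF E(1,3)] orbit_trans[OF E(3,2)] orbit_sym[OF E(2,3)] * that E by meson
    qed
  qed
  have un: "\<Union>?O = S" using sub refl by blast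
  have "card (\<Union>?O) = (\<Sum>X\<in>?O. card X)"
  proof (rule card_Union_disjoint)
    show "pairwise disjnt ?O"
    proof (rule pairwiseI)
      fix X Y assume "X \<in> ?O" "Y \<in> ?O" "X \<noteq> Y"
      then show "disjnt X Y" using orb by (fastforce simp: disjnt_def)
    qed
    show "finite X" if "X \<in> ?O" for X
      using that sub S(2) by (auto intro: finite_subset)
  qed
  also have "\<dots> = card (orbit G \<phi> x0) + (\<Sum>X\<in>?O - {orbit G \<phi> x0}. card X)"
    using S(2) x0(1) by (intro sum.remove) auto
  also have "orbit G \<phi> x0 = {x0}"
    using x0(2) one_closed by (auto simp: orbit_def intro: exI[of _ \<one>])
  finally have eq: "card S = 1 + (\<Sum>X\<in>?O - {{x0}}. card X)" by (simp add: un)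
  have "p dvd card X" if X: "X \<in> ?O - {{x0}}" for X
  proof -
    obtain x where x: "x \<in> S" "X = orbit G \<phi> x" "X \<noteq> {x0}" using X by auto
    have "x \<noteq> x0" using x \<open>orbit G \<phi> x0 = {x0}\<close> by auto
    then obtain g where g: "g \<in> carrier G" "\<phi> g x \<noteq> x" using no x(1) by blast
    have "card X dvd p ^ k"
      using orbit_stabilizer_theorem[of x] x S(1) assms(3) by (metis dvd_triv_left subsetD)
    then obtain j where j: "card X = p ^ j" using assms(2) divides_primepow_nat by blast
    have "{x, \<phi> g x} \<subseteq> X" using refl[OF x(1)] g x(2) by (auto simp: orbit_def)
    moreover have "finite X" using x sub S(2) finite_subset by blast
    ultimately have "card X \<ge> 2" using g(2) card_mono[of X "{x, \<phi> g x}"] by auto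
    then show ?thesis using j by (cases j) auto
  qed
  then have "p dvd (\<Sum>X\<in>?O - {{x0}}. card X)" by (rule dvd_sum)
  with eq S(3) have "p dvd 1" by (metis dvd_add_left_iff)
  with assms(2) show False by auto
qed

lemma (in group) subgroup_card_prime_power:
  assumes "prime p" "order G = p ^ k" "subgroup H G"
  obtains j where "j \<le> k" "card H = p ^ j"
proof -
  have "card H dvd p ^ k" using lagrange[OF assms(3)] assms(2) by (metis dvd_triv_right)
  then show ?thesis using that divides_primepow_nat assms(1) by blast
qed

text \<open>Under conjugation the fixed points in \<open>N\<close> are its central elements, and the
  identity is one of them; since \<open>p\<close> divides the order of \<open>N\<close>, there is
  another.\<close>

lemma (in group) center_meets_normal:
  assumes fin: "finite (carrier G)" and p: "prime p" "order G = p ^ k"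
    and N: "N \<lhd> G" "N \<noteq> {\<one>}"
  obtains z where "z \<in> N" "z \<noteq> \<one>" "\<And>g. g \<in> carrier G \<Longrightarrow> g \<otimes> z = z \<otimes> g"
proof -
  interpret N: normal N G by (rule N)
  interpret A: group_action G "carrier G" "\<lambda>g. \<lambda>h \<in> carrier G. g \<otimes> h \<otimes> inv g"
    by (rule action_by_conjugation)
  obtain j where j: "card N = p ^ j"
    using subgroup_card_prime_power[OF p N.is_subgroup] by blast
  have "j \<noteq> 0" using N(2) j subgroup_eq_one_iff[OF fin N.is_subgroup] by auto
  then have "p dvd card N" using j by simp
  moreover have "g \<otimes> x \<otimes> inv g \<in> N" if "g \<in> carrier G" "x \<in> N" for g x
    using that N(1) normal_inv_iff by blast
  ultimately obtain x where x: "x \<in> N" "x \<noteq> \<one>"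
    "\<forall>g \<in> carrier G. (\<lambda>h \<in> carrier G. g \<otimes> h \<otimes> inv g) x = x"
    using A.fixed_point_of_prime_power_order[OF fin p N.subset finite_subset[OF N.subset fin], of \<one>]
    by (auto simp: N.one_closed)
  have xc: "x \<in> carrier G" using x(1) N.subset by blast
  have "g \<otimes> x = x \<otimes> g" if "g \<in> carrier G" for g
  proof -
    have "g \<otimes> x \<otimes> inv g = x" using x(3) that xc by auto
    then show ?thesis using that xc by (metis inv_solve_right m_closed)
  qed
  then show ?thesis using that x by blast
qed

text \<open>If the centralizer of a maximal abelian normal subgroup \<open>A\<close> were larger than \<open>A\<close>, its image in
  \<open>G/A\<close> would contain a nontrivial central element \<open>Ax\<close>, and \<open>A\<close> together with \<open>x\<close> would generate a larger
  abelian normal subgroup.\<close>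

lemma (in group) self_centralizing_abelian_normal:
  assumes fin: "finite (carrier G)" and p: "prime p" "order G = p ^ k"
  obtains A where "A \<lhd> G" "\<And>x y. x \<in> A \<Longrightarrow> y \<in> A \<Longrightarrow> x \<otimes> y = y \<otimes> x"
    "\<And>x. x \<in> carrier G \<Longrightarrow> (\<And>y. y \<in> A \<Longrightarrow> x \<otimes> y = y \<otimes> x) \<Longrightarrow> x \<in> A"
proof -
  define F where "F = {A. A \<lhd> G \<and> (\<forall>x\<in>A. \<forall>y\<in>A. x \<otimes> y = y \<otimes> x)}"
  have "F \<subseteq> Pow (carrier G)" by (auto simp: F_def dest: normal_imp_subgroup subgroup.mem_carrier)
  then have "finite F" using fin finite_subset by blast
  have "{\<one>} \<in> F" by (simp add: F_def one_is_normal)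
  \<comment> \<open>Maximality is taken with respect to cardinality, so the strictly larger
    \<open>B\<close> constructed below is an immediate contradiction.\<close>
  obtain A where A: "A \<in> F" "\<And>B. B \<in> F \<Longrightarrow> card B \<le> card A"
    using \<open>finite F\<close> \<open>{\<one>} \<in> F\<close> Max_in[of "card ` F"] Max_ge[of "card ` F"]
    by (metis (no_types, lifting) empty_iff finite_imageI image_iff image_is_empty)
  have norm: "A \<lhd> G" and comm: "\<And>x y. x \<in> A \<Longrightarrow> y \<in> A \<Longrightarrow> x \<otimes> y = y \<otimes> x"
    using A(1) by (auto simp: F_def)
  interpret A: normal A G by (rule norm)
  define C where "C = {x \<in> carrier G. \<forall>y\<in>A. x \<otimes> y = y \<otimes> x}"
  have "x0 \<in> A" if x0: "x0 \<in> C" for x0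
  proof (rule ccontr)
    assume nx0: "x0 \<notin> A"
    have Csub: "C \<subseteq> carrier G" by (auto simp: C_def)
    have AC: "y \<in> carrier G" if "y \<in> A" for y using that A.subset by blast
    have C_conj: "g \<otimes> c \<otimes> inv g \<in> C" if g: "g \<in> carrier G" and c: "c \<in> C" for g c
    proof -
      have cc: "c \<in> carrier G" using c Csub by blast
      have "g \<otimes> c \<otimes> inv g \<otimes> y = y \<otimes> (g \<otimes> c \<otimes> inv g)" if y: "y \<in> A" for y
      proof -
        define y' where "y' = inv g \<otimes> y \<otimes> g"
        have y': "y' \<in> A" using A.inv_op_closed1[OF g y] by (simp add: y'_def)
        have yy: "y = g \<otimes> y' \<otimes> inv g" using g AC[OF y] by (simp add: y'_def conjugation_is_surj)
        have "c \<otimes> y' = y' \<otimes> c" using c y' by (auto simp: C_def)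
        then have "g \<otimes> (c \<otimes> y') \<otimes> inv g = g \<otimes> (y' \<otimes> c) \<otimes> inv g" by simp
        then show ?thesis using g cc AC[OF y'] unfolding yy
          by (simp add: m_assoc inv_solve_left) (simp add: m_assoc[symmetric])
      qed
      then show ?thesis using g cc by (auto simp: C_def)
    qed
    have subC: "subgroup C G"
    proof (rule subgroupI)
      show "C \<subseteq> carrier G" by fact
      show "C \<noteq> {}" using x0 by blast
      fix a assume a: "a \<in> C"
      then show "inv a \<in> C"
        using AC by (auto simp: C_def commute_inv)
      fix b assume b: "b \<in> C"
      show "a \<otimes> b \<in> C" using a b AC by (auto simp: C_def commute_mult)
    qed
    let ?Q = "G Mod A" and ?h = "\<lambda>x. A #> x"
    interpret h: group_hom G ?Q ?h
      by (simp add: A.factorgroup_is_group A.r_coset_hom_Mod group_hom_axioms_def group_hom_def is_group)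
    have Qc: "carrier ?Q = ?h ` carrier G" by (auto simp: FactGroup_def RCOSETS_def)
    have finQ: "finite (carrier ?Q)" using Qc fin by simp
    have ordQ: "order ?Q * card A = p ^ k"
      using lagrange[OF A.is_subgroup] p(2) by (simp add: order_def FactGroup_def)
    then obtain j where j: "order ?Q = p ^ j" by (metis divides_primepow_nat dvd_triv_left p(1))
    have "?h ` C \<lhd> ?Q"
      unfolding h.H.normal_inv_iff
    proof (intro conjI ballI)
      show "subgroup (?h ` C) ?Q" using subC h.subgroup_img_is_subgroup by blast
      fix u v assume "u \<in> carrier ?Q" "v \<in> ?h ` C"
      then obtain g c where gc: "g \<in> carrier G" "u = ?h g" "c \<in> C" "v = ?h c" using Qc by auto
      then have "u \<otimes>\<^bsub>?Q\<^esub> v \<otimes>\<^bsub>?Q\<^esub> inv\<^bsub>?Q\<^esub> u = ?h (g \<otimes> c \<otimes> inv g)"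
        using Csub by (simp add: subset_iff del: mult_FactGroup)
      then show "u \<otimes>\<^bsub>?Q\<^esub> v \<otimes>\<^bsub>?Q\<^esub> inv\<^bsub>?Q\<^esub> u \<in> ?h ` C" using C_conj gc by auto
    qed
    moreover have "?h ` C \<noteq> {\<one>\<^bsub>?Q\<^esub>}"
    proof
      assume "?h ` C = {\<one>\<^bsub>?Q\<^esub>}"
      then have "A #> x0 = A" using x0 by auto
      then show False using nx0 x0 Csub rcos_self[OF _ A.is_subgroup] by blast
    qed
    ultimately obtain Z where Z: "Z \<in> ?h ` C" "Z \<noteq> \<one>\<^bsub>?Q\<^esub>"
      "\<And>g. g \<in> carrier ?Q \<Longrightarrow> g \<otimes>\<^bsub>?Q\<^esub> Z = Z \<otimes>\<^bsub>?Q\<^esub> g"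
      using h.H.center_meets_normal[OF finQ p(1) j] by blast
    then obtain x where x: "x \<in> C" "Z = ?h x" by blast
    have xc: "x \<in> carrier G" using x Csub by blast
    have xA: "x \<notin> A" using Z(2) x(2) A.rcos_const by auto
    have xcomm: "x \<otimes> y = y \<otimes> x" if "y \<in> A" for y using x(1) that by (auto simp: C_def)
    have xpow: "x [^] (i::nat) \<otimes> y = y \<otimes> x [^] i" if "y \<in> A" for y i
      using pow_mem_subgroup[OF subC x(1), of i] that by (auto simp: C_def)
    define B where "B = {y \<otimes> x [^] (i::nat) | y i. y \<in> A}"
    \<comment> \<open>Centrality of \<open>Ax\<close> in \<open>G/A\<close> says that conjugation
      moves \<open>x\<close> only within the coset \<open>Ax\<close>; this is what makes
      \<open>B\<close> normal.\<close>
    have gx: "\<exists>u\<in>A. g \<otimes> x \<otimes> inv g = u \<otimes> x" if g: "g \<in> carrier G" for g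
    proof -
      have "?h g \<otimes>\<^bsub>?Q\<^esub> ?h x = ?h x \<otimes>\<^bsub>?Q\<^esub> ?h g" using Z(3) Qc g x by auto
      then have "A #> (g \<otimes> x) = A #> (x \<otimes> g)" using g xc by (simp flip: h.hom_mult del: mult_FactGroup)
      then have "g \<otimes> x \<in> A #> (x \<otimes> g)" using g xc rcos_self[OF _ A.is_subgroup] by (metis m_closed)
      then obtain u where u: "u \<in> A" "g \<otimes> x = u \<otimes> (x \<otimes> g)" by (auto simp: r_coset_def)
      then have "g \<otimes> x \<otimes> inv g = u \<otimes> x" using g xc AC by (simp add: m_assoc)
      then show ?thesis using u by blast
    qed
    have Bsub: "B \<subseteq> carrier G" using xc AC by (auto simp: B_def)
    have Bmult: "a \<otimes> b \<in> B" if "a \<in> B" "b \<in> B" for a b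
    proof -
      obtain y i y' i' where *: "a = y \<otimes> x [^] (i::nat)" "b = y' \<otimes> x [^] (i'::nat)" "y \<in> A" "y' \<in> A"
        using \<open>a \<in> B\<close> \<open>b \<in> B\<close> by (auto simp: B_def)
      have "a \<otimes> b = y \<otimes> (x [^] i \<otimes> y') \<otimes> x [^] i'" using * AC xc by (simp add: m_assoc)
      also have "\<dots> = (y \<otimes> y') \<otimes> x [^] (i + i')"
        using * AC xc xpow[of y' i] by (simp add: m_assoc nat_pow_mult)
      finally show ?thesis using * A.m_closed by (auto simp: B_def)
    qed
    have Bcomm: "a \<otimes> b = b \<otimes> a" if "a \<in> B" "b \<in> B" for a b
    proof -
      obtain y i y' i' where *: "a = y \<otimes> x [^] (i::nat)" "b = y' \<otimes> x [^] (i'::nat)" "y \<in> A" "y' \<in> A"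
        using \<open>a \<in> B\<close> \<open>b \<in> B\<close> by (auto simp: B_def)
      have "a \<otimes> b = y \<otimes> (x [^] i \<otimes> y') \<otimes> x [^] i'" using * AC xc by (simp add: m_assoc)
      also have "\<dots> = (y \<otimes> y') \<otimes> x [^] (i + i')"
        using * AC xc xpow[of y' i] by (simp add: m_assoc nat_pow_mult)
      also have "\<dots> = (y' \<otimes> y) \<otimes> x [^] (i' + i)" using comm * by (simp add: add.commute)
      also have "\<dots> = y' \<otimes> (x [^] i' \<otimes> y) \<otimes> x [^] i"
        using * AC xc xpow[of y i'] by (simp add: m_assoc nat_pow_mult)
      also have "\<dots> = b \<otimes> a" using * AC xc by (simp add: m_assoc)
      finally show ?thesis .
    qed
    have powB: "x [^] (i::nat) \<in> B" for i unfolding B_def using A.one_closed xc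
      by (auto intro!: exI[of _ \<one>] exI[of _ i])
    have AB: "A \<subseteq> B"
    proof
      fix y assume "y \<in> A"
      then have "y = y \<otimes> x [^] (0::nat)" using AC by simp
      then show "y \<in> B" using \<open>y \<in> A\<close> unfolding B_def by blast
    qed
    have subB: "subgroup B G"
    proof (rule subgroupI)
      show "B \<subseteq> carrier G" by fact
      show "B \<noteq> {}" using powB by blast
      fix a assume a: "a \<in> B"
      have pa: "a [^] (i::nat) \<in> B" for i
        by (induction i) (use powB[of 0] a Bmult in auto)
      have ac: "a \<in> carrier G" using a Bsub by blast
      \<comment> \<open>Inverses in a finite group are powers, so closure of \<open>B\<close> under
        products suffices.\<close>
      have "a \<otimes> a [^] (ord a - 1) = \<one>"
        using ord_ge_1[OF fin ac] ac by (metis One_nat_def Suc_pred less_eq_Suc_le nat_pow_Suc2 pow_ord_eq_1)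
      then have "inv a = a [^] (ord a - 1)" using ac inv_comm inv_equality by blast
      then show "inv a \<in> B" using pa by simp
      fix b assume "b \<in> B" then show "a \<otimes> b \<in> B" using a Bmult by blast
    qed
    have "B \<lhd> G"
      unfolding normal_inv_iff
    proof (intro conjI ballI)
      show "subgroup B G" by fact
      fix g b assume g: "g \<in> carrier G" and "b \<in> B"
      then obtain y i where b: "b = y \<otimes> x [^] (i::nat)" "y \<in> A" by (auto simp: B_def)
      obtain u where u: "u \<in> A" "g \<otimes> x \<otimes> inv g = u \<otimes> x" using gx g by blast
      have gxB: "g \<otimes> x \<otimes> inv g \<in> B"
        using u AB powB[of 1] Bmult xc by auto
      have "g \<otimes> x [^] i \<otimes> inv g \<in> B"
      proof (induction i)
        case 0 show ?case using g powB[of 0] by simp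
      next
        case (Suc i)
        have "g \<otimes> x [^] Suc i \<otimes> inv g = (g \<otimes> x [^] i \<otimes> inv g) \<otimes> (g \<otimes> x \<otimes> inv g)"
          using g xc by (simp add: m_assoc inv_solve_left)
        then show ?case using Suc gxB Bmult by simp
      qed
      moreover have "g \<otimes> y \<otimes> inv g \<in> B" using AB A.inv_op_closed2[OF g b(2)] by blast
      moreover have "g \<otimes> b \<otimes> inv g = (g \<otimes> y \<otimes> inv g) \<otimes> (g \<otimes> x [^] i \<otimes> inv g)"
        using g xc AC[OF b(2)] b(1) by (simp add: m_assoc inv_solve_left)
      ultimately show "g \<otimes> b \<otimes> inv g \<in> B" using Bmult by simp
    qed
    then have "B \<in> F" using Bcomm by (auto simp: F_def)
    then have "card B \<le> card A" by (rule A(2))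
    moreover have "finite B" using Bsub fin finite_subset by blast
    ultimately have "A = B" using AB card_seteq by blast
    then show False using xA powB[of 1] xc by simp
  qed
  then have "x \<in> A" if "x \<in> carrier G" "\<And>y. y \<in> A \<Longrightarrow> x \<otimes> y = y \<otimes> x" for x
    using that unfolding C_def by blast
  with norm comm show ?thesis by (rule that)
qed

section \<open>Elements of order p and cyclicity of abelian subgroups\<close>

lemma (in group) nat_pow_eq_iff_cong:
  assumes "x \<in> carrier G"
  shows "x [^] (i::nat) = x [^] (j::nat) \<longleftrightarrow> [i = j] (mod ord x)"
proof -
  have "x [^] i = x [^] j \<longleftrightarrow> int (ord x) dvd (int j - int i)"
    using int_pow_eq[OF assms, of "int i" "int j"] by (simp add: int_pow_int)
  also have "\<dots> \<longleftrightarrow> [i = j] (mod ord x)"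
    by (metis cong_iff_dvd_diff cong_int_iff cong_sym_eq)
  finally show ?thesis .
qed

lemma (in group) generate_subset_subgroup:
  assumes "subgroup H G" "x \<in> H"
  shows "generate G {x} \<subseteq> H"
  using generate_subgroup_incl[OF _ assms(1), of "{x}"] assms(2) by simp

lemma (in group) subgroup_generate: "x \<in> carrier G \<Longrightarrow> subgroup (generate G {x}) G"
  by (simp add: generate_is_subgroup)

lemma (in group) self_mem_generate: "x \<in> generate G {x}"
  by (simp add: generate.incl)

lemma (in group) pow_mem_generate: "x \<in> carrier G \<Longrightarrow> x [^] (i::nat) \<in> generate G {x}"
  by (simp add: pow_mem_subgroup self_mem_generate subgroup_generate)

text \<open>A cyclic \<open>p\<close>-group has only one subgroup of order \<open>p\<close>: for
  \<open>v = y^i\<close> the condition \<open>v^p = 1\<close> forces \<open>p^m\<close> to divide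
  \<open>i\<close>.\<close>

lemma (in group) prime_root_in_generate:
  assumes "finite (carrier G)" "y \<in> carrier G" "prime p" "ord y = p ^ Suc m"
    and "v \<in> generate G {y}" "v [^] p = \<one>"
  shows "v \<in> generate G {y [^] (p ^ m)}"
proof -
  obtain i :: nat where i: "v = y [^] i" using assms(5) generate_finite[OF assms(1,2)] by auto
  have "y [^] (i * p) = \<one>" using assms(2,6) i by (simp add: nat_pow_pow)
  then have "p ^ Suc m dvd i * p" using assms(2,4) by (simp add: pow_eq_id)
  then have "p ^ m dvd i" using assms(3) prime_gt_0_nat by simp
  then obtain j where "i = p ^ m * j" by blast
  then have "v = (y [^] (p ^ m)) [^] j" using assms(2) i by (simp add: nat_pow_pow)
  then show ?thesis using pow_mem_generate assms(2) by simp
qed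

lemma (in group) generate_prime_order:
  assumes "finite (carrier G)" "c \<in> carrier G" "prime p" "ord c = p" "w \<in> generate G {c}" "w \<noteq> \<one>"
  shows "generate G {w} = generate G {c}"
proof -
  have sub: "generate G {w} \<subseteq> generate G {c}"
    using assms by (simp add: generate_subset_subgroup subgroup_generate)
  have wc: "w \<in> carrier G" using assms(2,5) generate_in_carrier by blast
  have c: "card (generate G {c}) = p" using generate_pow_card assms(2,4) by simp
  then have "card (generate G {w}) dvd p"
    using card_subgroup_dvd[OF subgroup_generate[OF wc] subgroup_generate[OF assms(2)] sub] by simp
  moreover have "card (generate G {w}) \<noteq> 1"
    using subgroup_eq_one_iff[OF assms(1) subgroup_generate[OF wc]] self_mem_generate[of w] assms(6) by auto
  ultimately have "card (generate G {w}) = p" using assms(3) prime_nat_iff by blast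
  moreover have "finite (generate G {c})" 
    by (rule finite_subset[OF subgroup.subset[OF subgroup_generate[OF assms(2)]] assms(1)])
  ultimately show ?thesis using sub c by (simp add: card_subset_eq)
qed

text \<open>The element of order \<open>p\<close> is produced as a power of \<open>x\<close>, so
  that it lies in every subgroup containing \<open>x\<close>.\<close>

lemma (in group) exists_element_of_prime_order:
  assumes "prime p" "finite (carrier G)" "x \<in> carrier G" "x \<noteq> \<one>" "order G = p ^ k"
  obtains j where "ord (x [^] (p ^ j :: nat)) = p" "ord x = p ^ Suc j"
proof -
  have "ord x dvd p ^ k" using ord_dvd_group_order[OF assms(3)] assms(5) by simp
  then obtain i where i: "ord x = p ^ i" using assms(1) divides_primepow_nat by blast
  have "i \<noteq> 0" using i assms(3,4) ord_eq_1 by (metis power_0)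
  then obtain j where j: "i = Suc j" using not0_implies_Suc by blast
  have "ord (x [^] (p ^ j :: nat)) = p"
    using ord_pow[OF assms(3), of "p ^ j"] i j assms(1) by (auto simp: prime_gt_0_nat)
  then show ?thesis using that i j by blast
qed

text \<open>The map \<open>x -> x^p\<close> sends the \<open>p^(j+1)\<close>-torsion of the abelian
  group \<open>A\<close> into its \<open>p^j\<close>-torsion, and each nonempty fibre is a coset of
  the \<open>p\<close>-torsion. Every step up therefore multiplies the count by at most
  \<open>p\<close>.\<close>

lemma (in group) card_prime_power_roots_le:
  assumes fin: "finite (carrier G)" and A: "subgroup A G"
    and comm: "\<And>x y. x \<in> A \<Longrightarrow> y \<in> A \<Longrightarrow> x \<otimes> y = y \<otimes> x"
    and roots: "card {x \<in> A. x [^] p = \<one>} \<le> p"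
  shows "card {x \<in> A. x [^] (p ^ j :: nat) = \<one>} \<le> p ^ j"
proof (induction j)
  case 0
  have AC: "x \<in> carrier G" if "x \<in> A" for x by (rule subgroup.mem_carrier[OF A that])
  have "{x \<in> A. x [^] (p ^ 0 :: nat) = \<one>} \<subseteq> {\<one>}" using AC by auto
  then show ?case using card_mono[of "{\<one>}"] by fastforce
next
  case (Suc j)
  let ?S = "\<lambda>j. {x \<in> A. x [^] (p ^ j :: nat) = \<one>}"
  let ?F = "\<lambda>y. {x \<in> A. x [^] p = y}"
  have AC: "x \<in> carrier G" if "x \<in> A" for x by (rule subgroup.mem_carrier[OF A that])
  have finA: "finite A" by (rule finite_subset[OF subgroup.subset[OF A] fin])
  have fib: "card (?F y) \<le> p" for y
  proof (cases "?F y = {}")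
    case True
    then show ?thesis by (metis card.empty le0)
  next
    case False
    then obtain x0 where x0: "x0 \<in> A" "x0 [^] p = y" by blast
    have "?F y \<subseteq> (\<lambda>w. w \<otimes> x0) ` {x \<in> A. x [^] p = \<one>}"
    proof
      fix x assume x: "x \<in> ?F y"
      let ?w = "x \<otimes> inv x0"
      have wA: "?w \<in> A" using x x0 A by (simp add: subgroup.m_closed subgroup.m_inv_closed)
      have "?w [^] p = x [^] p \<otimes> inv x0 [^] p"
        using x x0 A AC comm by (intro pow_mult_distrib) (auto simp: subgroup.m_inv_closed)
      also have "\<dots> = \<one>" using x x0 AC by (auto simp: nat_pow_inv)
      finally have "?w [^] p = \<one>" .
      moreover have "x = ?w \<otimes> x0" using x x0 AC by (simp add: m_assoc)
      ultimately show "x \<in> (\<lambda>w. w \<otimes> x0) ` {x \<in> A. x [^] p = \<one>}" using wA by blast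
    qed
    then have "card (?F y) \<le> card {x \<in> A. x [^] p = \<one>}"
      using finA by (intro surj_card_le) auto
    then show ?thesis using roots by simp
  qed
  have "?S (Suc j) \<subseteq> (\<Union>y\<in>?S j. ?F y)"
  proof
    fix x assume x: "x \<in> ?S (Suc j)"
    then have "(x [^] p) [^] (p ^ j) = \<one>" using AC by (simp add: nat_pow_pow)
    then have "x [^] p \<in> ?S j" using x A pow_mem_subgroup by simp
    then show "x \<in> (\<Union>y\<in>?S j. ?F y)" using x by blast
  qed
  then have "card (?S (Suc j)) \<le> card (\<Union>y\<in>?S j. ?F y)"
    using finA by (intro card_mono) auto
  also have "\<dots> \<le> (\<Sum>y\<in>?S j. card (?F y))" using finA by (intro card_UN_le) auto
  also have "\<dots> \<le> card (?S j) * p" using sum_bounded_above[of "?S j" "\<lambda>y. card (?F y)" p] fib by simp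
  also have "\<dots> \<le> p ^ j * p" using Suc by simp
  finally show ?case by (simp add: mult.commute)
qed

text \<open>An element \<open>a\<close> of maximal order \<open>p^m\<close> satisfies
  \<open>x^(p^m) = 1\<close> for all \<open>x\<close> in \<open>A\<close>, as orders are powers of
  \<open>p\<close>. The bound on roots then leaves no room in \<open>A\<close> beyond the
  \<open>p^m\<close> powers of \<open>a\<close>.\<close>

lemma (in group) abelian_subgroup_cyclic:
  assumes fin: "finite (carrier G)" and p: "prime p" "order G = p ^ k"
    and A: "subgroup A G" and comm: "\<And>x y. x \<in> A \<Longrightarrow> y \<in> A \<Longrightarrow> x \<otimes> y = y \<otimes> x"
    and c: "c \<in> carrier G" "ord c = p"
    and roots: "\<And>w. w \<in> carrier G \<Longrightarrow> w [^] p = \<one> \<Longrightarrow> w \<in> generate G {c}"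
  obtains a where "a \<in> A" "A = generate G {a}"
proof -
  have AC: "x \<in> carrier G" if "x \<in> A" for x by (rule subgroup.mem_carrier[OF A that])
  have finA: "finite A" by (rule finite_subset[OF subgroup.subset[OF A] fin])
  have "finite (generate G {c})" by (rule finite_subset[OF subgroup.subset[OF subgroup_generate[OF c(1)]] fin])
  moreover have "{x \<in> A. x [^] p = \<one>} \<subseteq> generate G {c}" using AC roots by blast
  ultimately have "card {x \<in> A. x [^] p = \<one>} \<le> p"
    using card_mono generate_pow_card[OF c(1)] c(2) by metis
  note le = card_prime_power_roots_le[OF fin A comm this]
  have ex: "\<exists>i. ord x = p ^ i" if "x \<in> A" for x
    using ord_dvd_group_order[OF AC[OF that]] p divides_primepow_nat by metis
  have "ord ` A \<noteq> {}" using A subgroup.one_closed by blast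
  then obtain a where a: "a \<in> A" "\<And>x. x \<in> A \<Longrightarrow> ord x \<le> ord a"
    using finA Max_in[of "ord ` A"] Max_ge[of "ord ` A"] by fastforce
  obtain m where m: "ord a = p ^ m" using ex a by blast
  have "A \<subseteq> {x \<in> A. x [^] (p ^ m :: nat) = \<one>}"
  proof
    fix x assume x: "x \<in> A"
    obtain i where i: "ord x = p ^ i" using ex x by blast
    then have "i \<le> m" using a(2)[OF x] m p(1) power_le_imp_le_exp prime_gt_1_nat by metis
    then have "ord x dvd p ^ m" using i le_imp_power_dvd by simp
    then show "x \<in> {x \<in> A. x [^] (p ^ m :: nat) = \<one>}" using x AC pow_eq_id by simp
  qed
  then have "card A \<le> card {x \<in> A. x [^] (p ^ m :: nat) = \<one>}" using finA by (intro card_mono) auto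
  also have "\<dots> \<le> p ^ m" by (rule le)
  also have "\<dots> = card (generate G {a})" using m generate_pow_card AC a(1) by simp
  finally have "A = generate G {a}"
    using generate_subset_subgroup[OF A a(1)] finA card_seteq by blast
  then show ?thesis using that a(1) by blast
qed

section \<open>Calculating with the relation \<open>b a = a^r b\<close>\<close>

lemma (in group) twist_pow:
  assumes "a \<in> carrier G" "b \<in> carrier G" "b \<otimes> a = a [^] (r::nat) \<otimes> b"
  shows "b \<otimes> a [^] (i::nat) = a [^] (r * i) \<otimes> b"
proof (induction i)
  case 0 then show ?case using assms by simp
next
  case (Suc i)
  have "b \<otimes> a [^] Suc i = b \<otimes> a [^] i \<otimes> a" using assms by (simp add: m_assoc)
  also have "\<dots> = a [^] (r * i) \<otimes> (b \<otimes> a)" using Suc assms by (simp add: m_assoc)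
  also have "\<dots> = (a [^] (r * i) \<otimes> a [^] r) \<otimes> b" using assms by (simp add: m_assoc)
  also have "\<dots> = a [^] (r * Suc i) \<otimes> b" using assms(1) by (simp add: nat_pow_mult add.commute)
  finally show ?case .
qed

lemma (in group) pow_twist:
  assumes "a \<in> carrier G" "b \<in> carrier G" "b \<otimes> a = a [^] (r::nat) \<otimes> b"
  shows "b [^] (i::nat) \<otimes> a = a [^] (r ^ i) \<otimes> b [^] i"
proof (induction i)
  case 0 then show ?case using assms by simp
next
  case (Suc i)
  have "b [^] Suc i \<otimes> a = b \<otimes> (b [^] i \<otimes> a)"
    using assms(1,2) by (subst nat_pow_Suc2) (simp_all add: m_assoc)
  also have "\<dots> = b \<otimes> a [^] (r ^ i) \<otimes> b [^] i" using Suc assms by (simp add: m_assoc)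
  also have "\<dots> = a [^] (r ^ Suc i) \<otimes> (b \<otimes> b [^] i)"
    using twist_pow[OF assms, of "r ^ i"] assms by (simp add: m_assoc)
  also have "b \<otimes> b [^] i = b [^] Suc i" using assms(2) by (rule nat_pow_Suc2[symmetric])
  finally show ?case .
qed

text \<open>Moving a \<open>b\<close> to the right past a power of \<open>a\<close> multiplies the
  exponent by \<open>r\<close>, so the \<open>k\<close> factors contribute \<open>i\<close>,
  \<open>i r\<close>, ..., \<open>i r^(k-1)\<close>.\<close>

lemma (in group) twisted_product_pow:
  assumes "a \<in> carrier G" "b \<in> carrier G" "b \<otimes> a = a [^] (r::nat) \<otimes> b"
  shows "(a [^] (i::nat) \<otimes> b) [^] (k::nat) = a [^] (i * (\<Sum>j<k. r ^ j)) \<otimes> b [^] k"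
proof (induction k)
  case 0 then show ?case by simp
next
  case (Suc k)
  let ?s = "\<Sum>j<k. r ^ j"
  have s: "(\<Sum>j<Suc k. r ^ j) = 1 + r * ?s"
    by (simp add: sum.lessThan_Suc_shift sum_distrib_left del: sum.lessThan_Suc)
  have "(a [^] i \<otimes> b) [^] Suc k = (a [^] i \<otimes> b) \<otimes> (a [^] i \<otimes> b) [^] k"
    using assms(1,2) by (intro nat_pow_Suc2) simp
  also have "\<dots> = a [^] i \<otimes> (b \<otimes> a [^] (i * ?s)) \<otimes> b [^] k" using Suc assms by (simp add: m_assoc)
  also have "\<dots> = (a [^] i \<otimes> a [^] (r * (i * ?s))) \<otimes> (b \<otimes> b [^] k)"
    using twist_pow[OF assms] assms by (simp add: m_assoc)
  also have "\<dots> = a [^] (i * (1 + r * ?s)) \<otimes> b [^] Suc k"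
    unfolding nat_pow_Suc2[OF assms(2)] using assms(1,2) by (simp add: nat_pow_mult algebra_simps)
  finally show ?case unfolding s .
qed

section \<open>Self-centralizing cyclic normal subgroups\<close>

text \<open>Two assumptions produce the contradictions: by \<open>centralizer\<close> nothing
  outside \<open>A\<close> commutes with \<open>a\<close>, and by \<open>roots\<close> nothing
  outside \<open>A\<close> has order \<open>p\<close>.\<close>

locale self_centralizing_cyclic = group G for G (structure) +
  fixes a and p m k :: nat
  assumes fin: "finite (carrier G)"
    and p: "prime p"
    and order: "order G = p ^ k"
    and a [simp]: "a \<in> carrier G"
    and ord_a: "ord a = p ^ m"
    and normal: "generate G {a} \<lhd> G"
    and centralizer: "\<And>x. x \<in> carrier G \<Longrightarrow> x \<otimes> a = a \<otimes> x \<Longrightarrow> x \<in> generate G {a}"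
    and roots: "\<And>x. x \<in> carrier G \<Longrightarrow> x [^] p = \<one> \<Longrightarrow> x \<in> generate G {a}"
begin

abbreviation "A \<equiv> generate G {a}"

lemma mem_A_iff: "x \<in> A \<longleftrightarrow> (\<exists>i::nat. x = a [^] i)"
  using generate_finite[OF fin a] by auto

lemma A_carrier: "x \<in> A \<Longrightarrow> x \<in> carrier G"
  by (auto simp: mem_A_iff)

lemma A_subgroup: "subgroup A G"
  by (simp add: subgroup_generate)

lemma pow_a_mem: "a [^] (i::nat) \<in> A"
  by (auto simp: mem_A_iff)

lemma pow_a_eq_iff: "a [^] (i::nat) = a [^] (j::nat) \<longleftrightarrow> [i = j] (mod p ^ m)"
  using nat_pow_eq_iff_cong[OF a] ord_a by simp

lemma pow_a_eq_one_iff: "a [^] (i::nat) = \<one> \<longleftrightarrow> p ^ m dvd i"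
  using pow_eq_id[OF a] ord_a by simp

lemma obtain_twist:
  assumes "g \<in> carrier G"
  obtains r :: nat where "g \<otimes> a = a [^] r \<otimes> g"
proof -
  have "g \<otimes> a \<otimes> inv g \<in> A" using normal assms self_mem_generate[of a] normal_inv_iff by blast
  then obtain r :: nat where r: "g \<otimes> a \<otimes> inv g = a [^] r" by (auto simp: mem_A_iff)
  have "g \<otimes> a = (g \<otimes> a \<otimes> inv g) \<otimes> g" using assms by (simp add: m_assoc)
  then show ?thesis using that r by simp
qed

lemma mem_A_cancel:
  assumes "x \<in> A" "y \<in> carrier G" "x \<otimes> y \<in> A"
  shows "y \<in> A"
proof -
  have "inv x \<otimes> (x \<otimes> y) \<in> A"
    using assms A_subgroup by (simp add: subgroup.m_closed subgroup.m_inv_closed)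
  then show ?thesis using assms A_carrier[OF assms(1)] by (simp add: m_assoc[symmetric])
qed

text \<open>Solving \<open>i u + t \<equiv> 0\<close> modulo \<open>p\<^sup>m\<close> makes \<open>a\<^sup>i b\<close> an element outside \<open>A\<close> whose \<open>p\<close>-th power is trivial.\<close>

lemma splitting_contradiction:
  assumes b: "b \<in> carrier G" "b \<notin> A" "b [^] p = a [^] (p * t)" "b \<otimes> a = a [^] (r::nat) \<otimes> b"
    and u: "(\<Sum>j<p. r ^ j) = p * u" "coprime u p"
  shows False
proof -
  have "coprime u (p ^ m)" using u(2) by simp
  then obtain x where x: "[u * x = Suc 0] (mod p ^ m)" using cong_solve_coprime_nat by blast
  \<comment> \<open>\<open>x\<close> inverts \<open>u\<close> modulo \<open>p^m\<close>, and
    \<open>p^m - 1\<close> stands for -1 among the natural numbers; so \<open>i\<close> is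
    \<open>- t / u\<close>.\<close>
  define i where "i = x * (t * (p ^ m - 1))"
  have pos: "p ^ m \<ge> 1" using p by (simp add: prime_gt_0_nat Suc_leI)
  have "[u * i + t = 1 * (t * (p ^ m - 1)) + t] (mod p ^ m)"
    unfolding i_def using cong_scalar_right[OF x, of "t * (p ^ m - 1)"]
    by (intro cong_add) (simp_all add: mult.assoc)
  also have "1 * (t * (p ^ m - 1)) + t = t * p ^ m"
    using pos by (metis One_nat_def Suc_pred' add.commute less_eq_Suc_le mult.left_neutral mult_Suc_right)
  finally have "p ^ m dvd u * i + t" by (simp add: cong_0_iff[symmetric] cong_def)
  then have "p ^ m dvd i * (p * u) + p * t"
    by (metis add_mult_distrib2 dvd_mult mult.assoc mult.commute)
  then have "(a [^] i \<otimes> b) [^] p = \<one>"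
    using twisted_product_pow[OF a b(1,4), of i p] b(3) u(1) by (simp add: nat_pow_mult pow_a_eq_one_iff)
  then have "a [^] i \<otimes> b \<in> A" using roots b(1) by simp
  then show False using mem_A_cancel[OF pow_a_mem b(1)] b(2) by blast
qed

text \<open>If \<open>b^p = a^s\<close> with \<open>s\<close> prime to \<open>p\<close>, then
  \<open>b^p\<close> generates \<open>A\<close>, so \<open>a\<close> is a power of \<open>b\<close>
  and commutes with it, against self-centralization.\<close>

lemma pow_outside:
  assumes b: "b \<in> carrier G" "b \<notin> A" "b [^] p \<in> A"
  obtains t where "b [^] p = a [^] (p * t)"
proof -
  obtain s :: nat where s: "b [^] p = a [^] s" using b(3) by (auto simp: mem_A_iff)
  have "p dvd s"
  proof (rule ccontr)
    assume "\<not> p dvd s"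
    then have "coprime s (p ^ m)" using p by (metis coprime_commute coprime_power_right_iff prime_imp_coprime)
    then obtain x where "[s * x = 1] (mod p ^ m)" using cong_solve_coprime_nat by (metis One_nat_def)
    then have "a = a [^] (s * x)" using pow_a_eq_iff[of "s * x" 1] by simp
    also have "\<dots> = b [^] (p * x)" using s b(1) by (metis a nat_pow_pow)
    finally have "a = b [^] (p * x)" .
    then have "b \<otimes> a = a \<otimes> b" using b(1) by (metis nat_pow_Suc nat_pow_Suc2)
    then show False using centralizer b by blast
  qed
  then show ?thesis using that s by blast
qed

text \<open>Conjugation by \<open>b^p\<close> raises \<open>a\<close> to the power
  \<open>r^p\<close>, but \<open>b^p\<close> lies in the abelian group \<open>A\<close> and so fixes
  \<open>a\<close>.\<close>

lemma twist_exponent: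
  assumes b: "b \<in> carrier G" "b [^] p \<in> A" "b \<otimes> a = a [^] (r::nat) \<otimes> b"
  shows "[r ^ p = 1] (mod p ^ m)"
proof -
  obtain s :: nat where s: "b [^] p = a [^] s" using b(2) by (auto simp: mem_A_iff)
  have "a [^] (r ^ p) \<otimes> b [^] p = b [^] p \<otimes> a" using pow_twist[OF a b(1,3)] by simp
  also have "\<dots> = a [^] (1::nat) \<otimes> b [^] p" unfolding s using a by (metis nat_pow_Suc nat_pow_Suc2 nat_pow_eone)
  finally have "a [^] (r ^ p) = a [^] (1::nat)" using b(1) by simp
  then show ?thesis by (simp only: pow_a_eq_iff)
qed

lemma m_pos:
  assumes "b \<in> carrier G" "b \<notin> A"
  shows "m > 0"
proof (rule ccontr)
  assume "\<not> m > 0"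
  then have "a = \<one>" using ord_a ord_eq_1[OF a] by simp
  then show False using centralizer assms by simp
qed

text \<open>Since \<open>m > 0\<close>, the congruence \<open>r^p = 1\<close> may be read modulo
  \<open>p\<close>, where Fermat's theorem gives \<open>r^p = r\<close>.\<close>

lemma twist_cong_one:
  assumes b: "b \<in> carrier G" "b \<notin> A" "b [^] p \<in> A" "b \<otimes> a = a [^] (r::nat) \<otimes> b"
  obtains w where "r = 1 + p * w"
proof -
  have "[r ^ p = 1] (mod p ^ m)" by (rule twist_exponent[OF b(1,3,4)])
  moreover have "p dvd p ^ m" using m_pos[OF b(1,2)] by (simp add: dvd_power)
  ultimately have 1: "[r ^ p = 1] (mod p)" by (rule cong_dvd_modulus_nat)
  then have "\<not> p dvd r" using p
    by (metis cong_dvd_iff dvd_power dvd_trans nat_dvd_1_iff_1 not_prime_1 prime_gt_0_nat)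
  then have "[r ^ (p - 1) = 1] (mod p)" using fermat_theorem p by blast
  then have "[r * r ^ (p - 1) = r * 1] (mod p)" by (rule cong_scalar_left)
  moreover have "r * r ^ (p - 1) = r ^ p" using p prime_gt_0_nat by (metis power_eq_if not_gr_zero)
  ultimately have "[r = 1] (mod p)" using 1 by (metis cong_sym cong_trans mult.right_neutral)
  then have "r mod p = 1" using prime_gt_1_nat[OF p] by (simp add: cong_def)
  then have "r = 1 + p * (r div p)" by (metis add.commute mult_div_mod_eq)
  then show ?thesis by (rule that)
qed

text \<open>Modulo \<open>p^2\<close> only the terms of first order in \<open>p w\<close> survive.
  This precision decides whether the sum over \<open>j < p\<close> is \<open>p\<close> times a
  number prime to \<open>p\<close>.\<close>

lemma geometric_sum_cong:
  fixes w n :: nat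
  shows "[(\<Sum>j<n. (1 + p * w) ^ j) = n + p * w * (\<Sum>j<n. j)] (mod p ^ 2)"
proof -
  have "[(1 + p * w) ^ j = 1 + p * w * j] (mod p ^ 2)" for j
  proof (induction j)
    case 0 show ?case by simp
  next
    case (Suc j)
    have "[(1 + p * w) ^ Suc j = (1 + p * w) * (1 + p * w * j)] (mod p ^ 2)"
      using cong_scalar_left[OF Suc, of "1 + p * w"] by simp
    also have "(1 + p * w) * (1 + p * w * j) = 1 + p * w * Suc j + p ^ 2 * (w ^ 2 * j)"
      by (simp add: algebra_simps power2_eq_square)
    also have "[\<dots> = 1 + p * w * Suc j] (mod p ^ 2)" by (simp add: cong_def)
    finally show ?case .
  qed
  then have "[(\<Sum>j<n. (1 + p * w) ^ j) = (\<Sum>j<n. 1 + p * w * j)] (mod p ^ 2)" by (intro cong_sum)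
  also have "(\<Sum>j<n. 1 + p * w * j) = n + p * w * (\<Sum>j<n. j)"
    by (simp only: sum.distrib sum_distrib_left) simp
  finally show ?thesis .
qed

text \<open>Among the iterated \<open>p\<close>-th powers of \<open>x\<close>, the last one before
  entering \<open>A\<close> is the element \<open>b\<close> to which the congruences apply.\<close>

lemma exists_root_outside:
  assumes "x \<in> carrier G" "x \<notin> A"
  obtains j where "x [^] (p ^ j) \<notin> A" "x [^] (p ^ Suc j) \<in> A"
proof -
  have ex: "x [^] (p ^ k) \<in> A" using pow_order_eq_1[OF assms(1)] order pow_a_mem[of 0] by simp
  define l where "l = (LEAST l. x [^] (p ^ l) \<in> A)"
  have l: "x [^] (p ^ l) \<in> A" unfolding l_def by (rule LeastI[of _ k]) (rule ex)
  then have "l \<noteq> 0" using assms by (metis nat_pow_eone power_0)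
  then obtain j where j: "l = Suc j" using not0_implies_Suc by blast
  then have "x [^] (p ^ j) \<notin> A" using not_less_Least[of j "\<lambda>l. x [^] (p ^ l) \<in> A"] l_def by simp
  then show ?thesis using that l j by blast
qed

text \<open>For odd \<open>p\<close> the sum \<open>0 + 1 + ... + (p-1)\<close> is itself a multiple
  of \<open>p\<close>, so the first-order term vanishes modulo \<open>p^2\<close>. The geometric sum
  is then \<open>p\<close> modulo \<open>p^2\<close>, that is, \<open>p\<close> times a number prime
  to \<open>p\<close>, and an element of order \<open>p\<close> splits off.\<close>

lemma odd_prime_imp_cyclic:
  assumes "odd p"
  shows "carrier G = A"
proof (rule ccontr)
  assume "carrier G \<noteq> A"
  then obtain x where "x \<in> carrier G" "x \<notin> A" using A_carrier by blast
  then obtain j where j: "x [^] (p ^ j) \<notin> A" "x [^] (p ^ Suc j) \<in> A" by (rule exists_root_outside)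
  define b where "b = x [^] (p ^ j)"
  have b: "b \<in> carrier G" "b \<notin> A" "b [^] p \<in> A"
    using j \<open>x \<in> carrier G\<close> by (simp_all add: b_def nat_pow_pow mult.commute)
  obtain r where r: "b \<otimes> a = a [^] (r::nat) \<otimes> b" using obtain_twist b(1) by blast
  obtain w where w: "r = 1 + p * w" using twist_cong_one[OF b r] .
  obtain t where t: "b [^] p = a [^] (p * t)" using pow_outside[OF b] .
  obtain h where h: "p = 2 * h + 1" using assms by (elim oddE)
  have "2 * (\<Sum>j<p. j) = p * (p - 1)" by (induction p) (auto simp: algebra_simps)
  then have s: "(\<Sum>j<p. j) = p * h" using h by simp
  have "[(\<Sum>j<p. r ^ j) = p + p * w * (p * h)] (mod p ^ 2)"
    using geometric_sum_cong[of w p] unfolding w s .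
  also have "p + p * w * (p * h) = p + p ^ 2 * (w * h)" by (simp add: power2_eq_square)
  also have "[\<dots> = p] (mod p ^ 2)" by (simp add: cong_def)
  finally have "(\<Sum>j<p. r ^ j) mod p ^ 2 = p"
    using prime_gt_1_nat[OF p] by (simp add: cong_def power2_eq_square)
  then obtain q where "(\<Sum>j<p. r ^ j) = p ^ 2 * q + p" by (metis mult_div_mod_eq)
  then have "(\<Sum>j<p. r ^ j) = p * (p * q + 1)" by (simp add: power2_eq_square algebra_simps)
  moreover have "coprime (p * q + 1) p"
    by (metis coprime_1_left coprime_iff_gcd_eq_1 gcd.commute gcd_add_mult mult.commute)
  ultimately show False using splitting_contradiction[OF b(1,2) t r] by blast
qed

end

section \<open>The prime 2: elements outside A invert A\<close>

context self_centralizing_cyclic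
begin

text \<open>The divisibility hypothesis says that \<open>a^s\<close> squares to 1. Then
  \<open>s\<close> is a multiple of \<open>2^(m-1)\<close>, and the parity of the cofactor selects
  the alternative.\<close>

lemma involution_of_A:
  assumes "p = 2" "m \<ge> 1" "2 ^ m dvd 2 * s"
  shows "a [^] (s::nat) = \<one> \<or> a [^] s = a [^] (2 ^ (m - 1) :: nat)"
proof -
  obtain l where l: "m = Suc l" using assms(2) by (cases m) auto
  then obtain q where q: "s = 2 ^ l * q" using assms(3) by (auto elim: dvdE)
  show ?thesis
  proof (cases "even q")
    case True
    then have "2 ^ m dvd s" using q l by (auto elim!: evenE)
    then show ?thesis using pow_a_eq_one_iff assms(1) by simp
  next
    case False
    then obtain q' where "q = 2 * q' + 1" by (elim oddE)
    then have "s = 2 ^ l + 2 ^ m * q'" using q l by (simp add: algebra_simps)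
    then have "[s = 2 ^ l] (mod 2 ^ m)" by (simp add: cong_def)
    then show ?thesis using pow_a_eq_iff assms(1) l by simp
  qed
qed

text \<open>Here the geometric sum is \<open>1 + r = 2 (1 + w)\<close>, so an even \<open>w\<close>
  would allow splitting; hence \<open>r\<close> is 3 modulo 4. This makes \<open>r - 1\<close> twice
  an odd number \<open>q\<close>, so that modulo powers of 2 a factor \<open>r - 1\<close> costs
  only a single 2. That pins down first \<open>b^2\<close>, then \<open>r\<close>.\<close>

lemma outside_inverts:
  assumes p2: "p = 2" and b: "b \<in> carrier G" "b \<notin> A" "b [^] (2::nat) \<in> A"
  shows "m \<ge> 2" "b \<otimes> a = inv a \<otimes> b" "b [^] (2::nat) = a [^] (2 ^ (m - 1) :: nat)"
proof -
  have bp: "b [^] p \<in> A" using b(3) p2 by simp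
  obtain r where r: "b \<otimes> a = a [^] (r::nat) \<otimes> b" using obtain_twist b(1) by blast
  obtain w where w: "r = 1 + p * w" using twist_cong_one[OF b(1,2) bp r] .
  obtain t where t: "b [^] p = a [^] (p * t)" using pow_outside[OF b(1,2) bp] .
  have m: "m \<ge> 1" using m_pos[OF b(1,2)] by simp
  have "odd w"
  proof
    assume "even w"
    then have "coprime (1 + w) p" using p2 by simp
    moreover have "(\<Sum>j<p. r ^ j) = p * (1 + w)" using w p2 by (simp add: numeral_2_eq_2)
    ultimately show False using splitting_contradiction[OF b(1,2) t r] by blast
  qed
  then obtain v where v: "w = 2 * v + 1" by (elim oddE)
  have r3: "r = 4 * v + 3" using w v p2 by simp
  \<comment> \<open>For \<open>m = 1\<close> an odd exponent acts trivially on \<open>A\<close>, and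
    \<open>b\<close> would centralize \<open>a\<close>.\<close>
  show m2: "m \<ge> 2"
  proof (rule ccontr)
    assume "\<not> m \<ge> 2"
    then have "m = 1" using m by simp
    then have "a [^] r = a [^] (1::nat)" unfolding pow_a_eq_iff using p2 r3 by (simp add: cong_def) presburger
    then have "b \<otimes> a = a \<otimes> b" using r by simp
    then show False using centralizer b by blast
  qed
  obtain l where l: "m = Suc (Suc l)" using m2 by (metis Suc_le_D numeral_2_eq_2 Suc_le_mono)
  define q where "q = 2 * v + 1"
  have cop: "coprime (2 ^ n :: nat) q" for n by (simp add: q_def)
  \<comment> \<open>\<open>b\<close> commutes with its own square \<open>a^(p t)\<close>, so
    \<open>(r - 1) p t = 4 q t\<close> vanishes modulo \<open>2^m\<close>; as \<open>q\<close> is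
    odd, \<open>b^2\<close> has order at most 2.\<close>
  have "a [^] (r * (p * t)) \<otimes> b = a [^] (p * t) \<otimes> b"
    using twist_pow[OF a b(1) r, of "p * t"] t b(1) by (metis nat_pow_Suc nat_pow_Suc2)
  then have "a [^] (r * (p * t)) = a [^] (p * t)" using b(1) by simp
  then have "[r * (p * t) = p * t] (mod 2 ^ m)" unfolding pow_a_eq_iff using p2 by simp
  moreover have "r * (p * t) = 4 * (q * t) + p * t" using r3 p2 by (simp add: q_def algebra_simps)
  ultimately have "2 ^ m dvd 4 * (q * t)"
    by (metis cong_add_rcancel_0_nat cong_0_iff)
  then have "2 ^ l dvd q * t" using l by simp
  then have "2 ^ l dvd t" using cop[of l] coprime_dvd_mult_right_iff by blast
  then have "2 ^ m dvd 2 * (p * t)" using l p2 by simp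
  from involution_of_A[OF p2 m this] have "b [^] p = \<one> \<or> b [^] p = a [^] (2 ^ (m - 1) :: nat)"
    using t by simp
  then show bz: "b [^] (2::nat) = a [^] (2 ^ (m - 1) :: nat)" using roots b p2 by auto
  \<comment> \<open>From \<open>r^2 - 1 = 2 q (r + 1)\<close> with \<open>q\<close> odd,
    \<open>r + 1\<close> is 0 or \<open>2^(m-1)\<close> modulo \<open>2^m\<close>.\<close>
  have "[r ^ p = 1] (mod 2 ^ m)" using twist_exponent[OF b(1) bp r] p2 by simp
  moreover have "r ^ p = 2 * (q * (r + 1)) + 1"
    using r3 p2 by (simp add: q_def power2_eq_square algebra_simps)
  ultimately have "2 ^ m dvd 2 * (q * (r + 1))"
    by (metis cong_add_rcancel_0_nat cong_0_iff)
  then have "2 ^ Suc l dvd q * (r + 1)" unfolding l by (metis nat_mult_dvd_cancel1 pos2 power_Suc)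
  then have "2 ^ Suc l dvd r + 1" using cop[of "Suc l"] coprime_dvd_mult_right_iff by blast
  then have "2 ^ m dvd 2 * (1 + r)" unfolding l by (metis add.commute mult_dvd_mono dvd_refl power_Suc)
  from involution_of_A[OF p2 m this] have "a [^] (1 + r) = \<one>"
  proof
    \<comment> \<open>In the second case \<open>(a b)^2 = a^(1+r) b^2\<close> is the square of the
      involution of \<open>A\<close>, so \<open>a b\<close> would be a root of 1 outside
      \<open>A\<close>.\<close>
    assume z: "a [^] (1 + r) = a [^] (2 ^ (m - 1) :: nat)"
    have s: "(\<Sum>j<2. r ^ j) = 1 + r" by (simp add: numeral_2_eq_2)
    have "(a [^] (1::nat) \<otimes> b) [^] (2::nat) = a [^] (1 + r) \<otimes> b [^] (2::nat)"
      using twisted_product_pow[OF a b(1) r, of 1 2] unfolding s by simp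
    also have "\<dots> = a [^] (2 ^ (m - 1) + 2 ^ (m - 1) :: nat)" unfolding z bz by (simp add: nat_pow_mult)
    also have "\<dots> = \<one>" unfolding pow_a_eq_one_iff using l p2 by simp
    finally have "a [^] (1::nat) \<otimes> b \<in> A" using roots b(1) p2 by (metis a m_closed nat_pow_closed)
    then have "b \<in> A" by (rule mem_A_cancel[OF pow_a_mem b(1)])
    then show ?thesis using b(2) by blast
  qed
  then have "a [^] r \<otimes> a = \<one>" by simp
  then have "inv a = a [^] r" by (intro inv_equality) simp_all
  then show "b \<otimes> a = inv a \<otimes> b" using r by simp
qed

text \<open>Otherwise some \<open>d^2\<close> outside \<open>A\<close> inverts \<open>a\<close>. If
  \<open>d\<close> acts on \<open>a\<close> by the exponent \<open>s\<close>, then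
  \<open>s^2 = -1\<close> modulo \<open>2^m\<close>, hence modulo 4, where -1 is not a
  square.\<close>

lemma square_mem_A:
  assumes p2: "p = 2" and x: "x \<in> carrier G" "x \<notin> A"
  shows "x [^] (2::nat) \<in> A"
proof (rule ccontr)
  assume nx: "x [^] (2::nat) \<notin> A"
  have "x [^] (2::nat) \<in> carrier G" using x by simp
  then obtain j where j: "(x [^] (2::nat)) [^] (p ^ j) \<notin> A" "(x [^] (2::nat)) [^] (p ^ Suc j) \<in> A"
    using nx by (rule exists_root_outside)
  define d where "d = x [^] (2 ^ j :: nat)"
  have d: "d \<in> carrier G" using x by (simp add: d_def)
  have b: "d [^] (2::nat) \<in> carrier G" "d [^] (2::nat) \<notin> A" "(d [^] (2::nat)) [^] (2::nat) \<in> A"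
    using j p2 x by (simp_all add: d_def nat_pow_pow mult_ac)
  obtain s where s: "d \<otimes> a = a [^] (s::nat) \<otimes> d" using obtain_twist d by blast
  have "a [^] (s ^ 2) \<otimes> d [^] (2::nat) = inv a \<otimes> d [^] (2::nat)"
    using pow_twist[OF a d s, of 2] outside_inverts(2)[OF p2 b] by simp
  then have "a [^] (s ^ 2) = inv a" using d by simp
  then have "a [^] (s ^ 2 + 1) = \<one>" by simp
  then have "2 ^ m dvd s ^ 2 + 1" unfolding pow_a_eq_one_iff using p2 by simp
  moreover have "(4::nat) dvd 2 ^ m"
    using le_imp_power_dvd[OF outside_inverts(1)[OF p2 b], of 2] by simp
  ultimately have "4 dvd s ^ 2 + 1" using dvd_trans by blast
  moreover have "\<exists>q. s ^ 2 = 4 * q \<or> s ^ 2 = 4 * q + 1"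
  proof (cases "even s")
    case True
    then obtain h where "s = 2 * h" by (elim evenE)
    then have "s ^ 2 = 4 * h ^ 2" by (simp add: power2_eq_square)
    then show ?thesis by blast
  next
    case False
    then obtain h where "s = 2 * h + 1" by (elim oddE)
    then have "s ^ 2 = 4 * (h * h + h) + 1" by (simp add: power2_eq_square algebra_simps)
    then show ?thesis by blast
  qed
  ultimately show False by presburger
qed

text \<open>If \<open>b\<close> and \<open>c\<close> both invert \<open>a\<close>, then
  \<open>c b^-1\<close> centralizes \<open>a\<close> and therefore lies in \<open>A\<close>; so
  there is only one coset besides \<open>A\<close>.\<close>

lemma even_prime_structure:
  assumes p2: "p = 2" and ne: "carrier G \<noteq> A"
  obtains b where "b \<in> carrier G" "b \<notin> A" "m \<ge> 2" "b \<otimes> a = inv a \<otimes> b"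
    "b [^] (2::nat) = a [^] (2 ^ (m - 1) :: nat)" "carrier G = A \<union> (\<lambda>x. x \<otimes> b) ` A"
proof -
  obtain b where b: "b \<in> carrier G" "b \<notin> A" using ne A_carrier by blast
  note ib = outside_inverts[OF p2 b square_mem_A[OF p2 b]]
  have "c \<in> (\<lambda>x. x \<otimes> b) ` A" if c: "c \<in> carrier G" "c \<notin> A" for c
  proof -
    note ic = outside_inverts(2)[OF p2 c square_mem_A[OF p2 c]]
    have ba: "inv b \<otimes> inv a = a \<otimes> inv b"
    proof -
      have "inv b \<otimes> (inv a \<otimes> b) \<otimes> inv b = inv b \<otimes> inv a" using b(1) by (simp add: m_assoc)
      moreover have "inv b \<otimes> (b \<otimes> a) \<otimes> inv b = a \<otimes> inv b" using b(1) by (simp add: m_assoc[symmetric])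
      ultimately show ?thesis using ib(2) by simp
    qed
    have "inv b \<otimes> a = inv a \<otimes> inv b"
    proof -
      have "a \<otimes> (inv b \<otimes> a) = inv b \<otimes> inv a \<otimes> a" using ba b(1) by (simp add: m_assoc)
      also have "\<dots> = inv b" using b(1) by (simp add: m_assoc)
      finally show ?thesis using b(1) by (metis a inv_closed inv_solve_left m_closed)
    qed
    then have "c \<otimes> inv b \<otimes> a = (c \<otimes> inv a) \<otimes> inv b" using b(1) c(1) by (simp add: m_assoc)
    moreover have "c \<otimes> inv a = a \<otimes> c"
    proof -
      have "a \<otimes> (c \<otimes> a) = c" using ic c(1) by (simp add: m_assoc[symmetric])
      then have "(a \<otimes> c) \<otimes> a \<otimes> inv a = c \<otimes> inv a" using c(1) by (simp add: m_assoc)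
      then show ?thesis using c(1) by (simp add: m_assoc)
    qed
    ultimately have "c \<otimes> inv b \<otimes> a = a \<otimes> (c \<otimes> inv b)" using b(1) c(1) by (simp add: m_assoc)
    then have "c \<otimes> inv b \<in> A" using centralizer b(1) c(1) by simp
    moreover have "c = c \<otimes> inv b \<otimes> b" using b(1) c(1) by (simp add: m_assoc)
    ultimately show ?thesis by blast
  qed
  then have "carrier G = A \<union> (\<lambda>x. x \<otimes> b) ` A" using A_carrier b(1) by blast
  then show ?thesis using that b ib by blast
qed

end

text \<open>The hypothesis puts the roots of 1 into the group generated by \<open>c\<close>, whereas
  the locale wants them in \<open>A\<close>. The link is that \<open>A\<close>, being nontrivial,
  contains an element of order \<open>p\<close>, which generates the same subgroup as
  \<open>c\<close>.\<close>

lemma (in group) unique_prime_subgroup_structure: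
  assumes fin: "finite (carrier G)" and p: "prime p" "order G = p ^ k"
    and c: "c \<in> carrier G" "ord c = p"
    and roots: "\<And>w. w \<in> carrier G \<Longrightarrow> w [^] p = \<one> \<Longrightarrow> w \<in> generate G {c}"
  shows "(\<exists>a \<in> carrier G. carrier G = generate G {a}) \<or>
    (\<exists>a b m. a \<in> carrier G \<and> b \<in> carrier G \<and> ord a = 2 ^ m \<and> m \<ge> 2 \<and> b \<notin> generate G {a} \<and>
      b \<otimes> a = inv a \<otimes> b \<and> b [^] (2::nat) = a [^] (2 ^ (m - 1) :: nat) \<and>
      carrier G = generate G {a} \<union> (\<lambda>x. x \<otimes> b) ` generate G {a})"
proof -
  obtain A where A: "A \<lhd> G" "\<And>x y. x \<in> A \<Longrightarrow> y \<in> A \<Longrightarrow> x \<otimes> y = y \<otimes> x"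
    "\<And>x. x \<in> carrier G \<Longrightarrow> (\<And>y. y \<in> A \<Longrightarrow> x \<otimes> y = y \<otimes> x) \<Longrightarrow> x \<in> A"
    using self_centralizing_abelian_normal[OF fin p] by blast
  have sA: "subgroup A G" by (rule normal_imp_subgroup[OF A(1)])
  obtain a where a: "a \<in> A" "A = generate G {a}"
    using abelian_subgroup_cyclic[OF fin p sA A(2) c roots] by blast
  have ac: "a \<in> carrier G" using subgroup.mem_carrier[OF sA a(1)] .
  obtain m where m: "ord a = p ^ m"
    using ord_dvd_group_order[OF ac] p divides_primepow_nat by metis
  have cent: "x \<in> A" if x: "x \<in> carrier G" "x \<otimes> a = a \<otimes> x" for x
  proof (rule A(3)[OF x(1)])
    fix y assume "y \<in> A"
    then obtain i :: nat where y: "y = a [^] i" using a(2) generate_finite[OF fin ac] by auto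
    have "x \<otimes> a = a [^] (1::nat) \<otimes> x" using x ac by simp
    from twist_pow[OF ac x(1) this, of i] show "x \<otimes> y = y \<otimes> x" using y by simp
  qed
  \<comment> \<open>A trivial \<open>A\<close> would have \<open>c\<close> in its centralizer, hence
    in itself.\<close>
  have "A \<noteq> {\<one>}"
  proof
    assume one: "A = {\<one>}"
    then have "a = \<one>" using a(1) by simp
    then have "c \<in> A" using cent c(1) by simp
    then have "c = \<one>" using one by simp
    then show False using c(2) p(1) ord_id not_prime_1 by metis
  qed
  then obtain w where w: "w \<in> A" "w \<noteq> \<one>" using subgroup.one_closed[OF sA] by blast
  have wc: "w \<in> carrier G" using subgroup.mem_carrier[OF sA w(1)] .
  obtain j where j: "ord (w [^] (p ^ j :: nat)) = p"
    using exists_element_of_prime_order[OF p(1) fin wc w(2) p(2)] by blast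
  define v where "v = w [^] (p ^ j :: nat)"
  have v: "v \<in> A" "v \<in> carrier G" "ord v = p" "v \<noteq> \<one>" "v [^] p = \<one>"
    using pow_mem_subgroup[OF sA w(1)] wc j p(1) pow_ord_eq_1[of v] by (auto simp: v_def)
  have "generate G {c} = generate G {v}"
    using generate_prime_order[OF fin c(1) p(1) c(2) roots[OF v(2,5)] v(4)] by simp
  also have "\<dots> \<subseteq> A" by (rule generate_subset_subgroup[OF sA v(1)])
  finally have rootsA: "x \<in> A" if "x \<in> carrier G" "x [^] p = \<one>" for x using roots that by blast
  interpret self_centralizing_cyclic G a p m k
    using fin p ac m A(1) cent rootsA unfolding a(2)
    by (intro self_centralizing_cyclic.intro self_centralizing_cyclic_axioms.intro is_group)
  show ?thesis
  proof (cases "carrier G = generate G {a}")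
    case True
    then show ?thesis using ac by blast
  next
    case False
    then have p2: "p = 2" using odd_prime_imp_cyclic p(1) prime_odd_nat by (metis prime_ge_2_nat le_neq_implies_less)
    obtain b where "b \<in> carrier G" "b \<notin> generate G {a}" "m \<ge> 2" "b \<otimes> a = inv a \<otimes> b"
      "b [^] (2::nat) = a [^] (2 ^ (m - 1) :: nat)" "carrier G = generate G {a} \<union> (\<lambda>x. x \<otimes> b) ` generate G {a}"
      using even_prime_structure[OF p2 False] by blast
    moreover have "ord a = 2 ^ m" using m p2 by simp
    ultimately show ?thesis using ac by blast
  qed
qed

section \<open>Presented groups and generalized quaternion groups\<close>

definition (in group) word_eval :: "('g \<Rightarrow> 'a) \<Rightarrow> 'g word \<Rightarrow> 'a"
  where "word_eval f w = foldr (\<lambda>(g, e) x. (if e then f g else inv (f g)) \<otimes> x) w \<one>"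

lemma (in group) word_eval_simps [simp]:
  "word_eval f [] = \<one>"
  "word_eval f ((g, e) # w) = (if e then f g else inv (f g)) \<otimes> word_eval f w"
  by (simp_all add: word_eval_def)

context group
begin

context
  fixes f :: "'g \<Rightarrow> 'a"
  assumes f [simp]: "\<And>g. f g \<in> carrier G"
begin

lemma word_eval_closed [simp]: "word_eval f w \<in> carrier G"
  by (induction w) auto

lemma word_eval_append: "word_eval f (u @ v) = word_eval f u \<otimes> word_eval f v"
  by (induction u) (auto simp: m_assoc)

lemma word_eval_replicate: "word_eval f (replicate k (g, True)) = f g [^] k"
  by (induction k) (auto simp: nat_pow_Suc2[symmetric] simp del: nat_pow_Suc)

lemma word_eval_pres_cong:
  assumes "\<And>r s. (r, s) \<in> R \<Longrightarrow> word_eval f r = word_eval f s" "pres_cong R u v"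
  shows "word_eval f u = word_eval f v"
  using assms(2)
proof induction
  case (cancel u g e v)
  have "x \<otimes> (inv x \<otimes> y) = y" "inv x \<otimes> (x \<otimes> y) = y" if "x \<in> carrier G" "y \<in> carrier G" for x y
    using that by (simp_all add: m_assoc[symmetric])
  then show ?case by (simp add: word_eval_append)
next
  case (rel r s u v)
  then show ?case using assms(1) by (simp add: word_eval_append)
qed auto

text \<open>This is von Dyck's theorem. Evaluation is constant on congruence classes, so
  \<open>h\<close> may evaluate whichever representative \<open>SOME\<close> picks.\<close>

lemma presented_group_hom:
  assumes "\<And>r s. (r, s) \<in> R \<Longrightarrow> word_eval f r = word_eval f s"
  shows "\<exists>h \<in> hom (presented_group R) G. \<forall>u. h (pres_class R u) = word_eval f u"
proof -
  define h where "h C = word_eval f (SOME u. u \<in> C)" for C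
  have h: "h (pres_class R u) = word_eval f u" for u
  proof -
    have "pres_cong R u (SOME v. v \<in> pres_class R u)"
      using someI[of "\<lambda>v. v \<in> pres_class R u" u] by (simp add: pres_class_def pres_cong.refl)
    from word_eval_pres_cong[OF assms this] show ?thesis by (simp add: h_def)
  qed
  have "h \<in> hom (presented_group R) G"
  proof (rule homI)
    have c: "carrier (presented_group R) = range (pres_class R)" by (simp add: presented_group_def)
    fix x assume "x \<in> carrier (presented_group R)"
    then obtain u where u: "x = pres_class R u" using c by blast
    then show "h x \<in> carrier G" by (simp add: h)
    fix y assume "y \<in> carrier (presented_group R)"
    then obtain v where "y = pres_class R v" using c by blast
    then show "h (x \<otimes>\<^bsub>presented_group R\<^esub> y) = h x \<otimes> h y"
      using u by (simp add: h mult_pres_class word_eval_append)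
  qed
  then show ?thesis using h by blast
qed

end

end

text \<open>The relations are read in an arbitrary group because they are applied to three: the
  presented group, \<open>G\<close> itself, and the bijections of pairs of complex numbers.\<close>

definition quaternion_relations :: "('a, 'b) monoid_scheme \<Rightarrow> nat \<Rightarrow> 'a \<Rightarrow> 'a \<Rightarrow> bool"
  where "quaternion_relations G n a b \<longleftrightarrow> a \<in> carrier G \<and> b \<in> carrier G \<and>
    a [^]\<^bsub>G\<^esub> (2 ^ (n - 2) :: nat) = b [^]\<^bsub>G\<^esub> (2::nat) \<and> a [^]\<^bsub>G\<^esub> (2 ^ (n - 1) :: nat) = \<one>\<^bsub>G\<^esub> \<and>
    inv\<^bsub>G\<^esub> b \<otimes>\<^bsub>G\<^esub> a \<otimes>\<^bsub>G\<^esub> b = inv\<^bsub>G\<^esub> a"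

text \<open>The natural number \<open>2^(n-1) - 1\<close> replaces the exponent -1, so that the
  calculations with \<open>b a = a^r b\<close> apply.\<close>

lemma (in group) quaternion_twist:
  assumes rel: "quaternion_relations G n a b"
  shows "inv a = a [^] (2 ^ (n - 1) - 1 :: nat)" "b \<otimes> a = a [^] (2 ^ (n - 1) - 1 :: nat) \<otimes> b"
proof -
  define M :: nat where "M = 2 ^ (n - 1)"
  have Mpos: "M > 0" by (simp add: M_def)
  have a: "a \<in> carrier G" and b: "b \<in> carrier G"
    and a1: "a [^] M = \<one>" and inv: "inv b \<otimes> a \<otimes> b = inv a"
    using rel by (auto simp: quaternion_relations_def M_def)
  have "a \<otimes> a [^] (M - 1) = \<one>" using a1 a Mpos by (metis Suc_diff_1 nat_pow_Suc2)
  then have inva: "inv a = a [^] (M - 1)" using a by (metis inv_comm inv_equality nat_pow_closed)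
  then show "inv a = a [^] (2 ^ (n - 1) - 1 :: nat)" by (simp add: M_def)
  have "a \<otimes> b = b \<otimes> inv a"
  proof -
    have "b \<otimes> (inv b \<otimes> a \<otimes> b) = a \<otimes> b" using a b by (simp add: m_assoc[symmetric])
    then show ?thesis using inv by simp
  qed
  then have "inv a \<otimes> (a \<otimes> b) \<otimes> a = inv a \<otimes> (b \<otimes> inv a) \<otimes> a" by simp
  moreover have "inv a \<otimes> (b \<otimes> inv a) \<otimes> a = inv a \<otimes> b" using a b by (simp add: m_assoc)
  moreover have "inv a \<otimes> (a \<otimes> b) \<otimes> a = b \<otimes> a" using a b by (simp add: m_assoc[symmetric])
  ultimately have "b \<otimes> a = a [^] (M - 1) \<otimes> b" by (simp add: inva)
  then show "b \<otimes> a = a [^] (2 ^ (n - 1) - 1 :: nat) \<otimes> b" by (simp add: M_def)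
qed

text \<open>The products \<open>a^i b^j\<close> are closed under left multiplication by
  \<open>a\<close> and \<open>b\<close>, and the inverses of these are positive powers; so every
  word evaluates to such a product. The relations then bound both exponents, leaving at most
  \<open>2^n\<close> values.\<close>

lemma (in group) quaternion_normal_form:
  assumes n: "n \<ge> 3" and rel: "quaternion_relations G n a b"
  shows "\<exists>i<2 ^ (n - 1). \<exists>s<2. word_eval (case_quat_gen a b) w = a [^] (i::nat) \<otimes> b [^] (s::nat)"
proof -
  let ?f = "case_quat_gen a b"
  define M :: nat where "M = 2 ^ (n - 1)"
  define L :: nat where "L = 2 ^ (n - 2)"
  have M_eq: "M = 2 * L"
    using n unfolding M_def L_def by (simp add: Suc_diff_le numeral_2_eq_2 flip: power_Suc)
  have Mpos: "M > 0" by (simp add: M_def)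
  have a: "a \<in> carrier G" and b: "b \<in> carrier G" and ab: "a [^] L = b [^] (2::nat)"
    and a1: "a [^] M = \<one>"
    using rel by (auto simp: quaternion_relations_def M_def L_def)
  have f: "?f g \<in> carrier G" for g using a b by (cases g) auto
  have inva: "inv a = a [^] (M - 1)" using quaternion_twist(1)[OF rel] by (simp add: M_def)
  have "b [^] (4::nat) = (b [^] (2::nat)) [^] (2::nat)" using b by (simp add: nat_pow_pow)
  also have "\<dots> = \<one>" using a a1 M_eq unfolding ab[symmetric] by (simp add: nat_pow_pow mult.commute)
  finally have "b \<otimes> b [^] (3::nat) = \<one>" using b by (metis nat_pow_Suc2 numeral_3_eq_3 eval_nat_numeral(2) semiring_norm(26) semiring_norm(27))
  then have invb: "inv b = b [^] (3::nat)" using b by (metis inv_comm inv_equality nat_pow_closed)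
  have "b \<otimes> a = a [^] (M - 1) \<otimes> b" using quaternion_twist(2)[OF rel] by (simp add: M_def)
  note tw = twist_pow[OF a b this]
  define N where "N = {a [^] (i::nat) \<otimes> b [^] (j::nat) | i j. True}"
  have aN: "a \<otimes> x \<in> N" if "x \<in> N" for x
  proof -
    obtain i j where "x = a [^] (i::nat) \<otimes> b [^] (j::nat)" using \<open>x \<in> N\<close> by (auto simp: N_def)
    then have "a \<otimes> x = a [^] Suc i \<otimes> b [^] j" using a b unfolding nat_pow_Suc2[OF a] by (simp add: m_assoc)
    then show ?thesis unfolding N_def by blast
  qed
  have bN: "b \<otimes> x \<in> N" if "x \<in> N" for x
  proof -
    obtain i j where "x = a [^] (i::nat) \<otimes> b [^] (j::nat)" using \<open>x \<in> N\<close> by (auto simp: N_def)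
    then have "b \<otimes> x = (b \<otimes> a [^] i) \<otimes> b [^] j" using a b by (simp add: m_assoc)
    also have "\<dots> = a [^] ((M - 1) * i) \<otimes> b [^] Suc j"
      using a b unfolding tw nat_pow_Suc2[OF b] by (simp add: m_assoc)
    finally show ?thesis unfolding N_def by blast
  qed
  have NC: "x \<in> carrier G" if "x \<in> N" for x using that a b by (auto simp: N_def)
  have apN: "a [^] (i::nat) \<otimes> x \<in> N" if "x \<in> N" for x i
  proof (induction i)
    case 0 then show ?case using NC that by simp
  next
    case (Suc i) then show ?case using aN[OF Suc] a NC[OF that] unfolding nat_pow_Suc2[OF a] by (simp add: m_assoc)
  qed
  have bpN: "b [^] (i::nat) \<otimes> x \<in> N" if "x \<in> N" for x i
  proof (induction i)
    case 0 then show ?case using NC that by simp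
  next
    case (Suc i) then show ?case using bN[OF Suc] b NC[OF that] unfolding nat_pow_Suc2[OF b] by (simp add: m_assoc)
  qed
  have "word_eval ?f w \<in> N"
  proof (induction w)
    case Nil
    have "\<one> = a [^] (0::nat) \<otimes> b [^] (0::nat)" by simp
    then show ?case unfolding word_eval_simps N_def by blast
  next
    case (Cons l w)
    obtain g e where l: "l = (g, e)" by (cases l)
    show ?case unfolding l using Cons aN bN apN bpN
      by (cases g) (auto simp: inva invb)
  qed
  then obtain i j where ij: "word_eval ?f w = a [^] (i::nat) \<otimes> b [^] (j::nat)" by (auto simp: N_def)
  \<comment> \<open>Each \<open>b^2\<close> becomes \<open>a^L\<close> and is absorbed into the
    power of \<open>a\<close>, whose exponent counts modulo \<open>M\<close>.\<close>
  define i' where "i' = (i + L * (j div 2)) mod M"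
  have "b [^] j = b [^] (2 * (j div 2) + j mod 2)" by simp
  also have "\<dots> = (b [^] (2::nat)) [^] (j div 2) \<otimes> b [^] (j mod 2)"
    using b by (simp only: nat_pow_pow nat_pow_mult)
  also have "(b [^] (2::nat)) [^] (j div 2) = a [^] (L * (j div 2))" using a by (simp add: ab[symmetric] nat_pow_pow)
  finally have "word_eval ?f w = a [^] (i + L * (j div 2)) \<otimes> b [^] (j mod 2)"
    using a b by (simp add: ij m_assoc[symmetric] nat_pow_mult)
  moreover have "a [^] (i + L * (j div 2)) = a [^] i'"
  proof -
    have "a [^] (i + L * (j div 2)) = a [^] (M * ((i + L * (j div 2)) div M) + i')"
      unfolding i'_def by simp
    also have "\<dots> = (a [^] M) [^] ((i + L * (j div 2)) div M) \<otimes> a [^] i'"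
      using a by (simp only: nat_pow_pow nat_pow_mult)
    finally show ?thesis using a1 a by simp
  qed
  ultimately have "word_eval ?f w = a [^] i' \<otimes> b [^] (j mod 2)" by simp
  moreover have "i' < 2 ^ (n - 1)" using Mpos by (simp add: i'_def M_def)
  moreover have "j mod 2 < 2" by simp
  ultimately show ?thesis by blast
qed

definition quat_rels :: "nat \<Rightarrow> (quat_gen word \<times> quat_gen word) set"
  where "quat_rels n = {(replicate (2 ^ (n - 2)) (Gen_a, True), replicate 2 (Gen_b, True)),
     (replicate (2 ^ (n - 1)) (Gen_a, True), []),
     ([(Gen_b, False), (Gen_a, True), (Gen_b, True)], [(Gen_a, False)])}"

lemma gen_quaternion_group_eq: "gen_quaternion_group n = presented_group (quat_rels n)"
  by (simp add: gen_quaternion_group_def quat_rels_def)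

lemma (in group) gen_quaternion_hom:
  assumes rel: "quaternion_relations G n a b"
  shows "\<exists>h \<in> hom (gen_quaternion_group n) G.
    \<forall>u. h (pres_class (quat_rels n) u) = word_eval (case_quat_gen a b) u"
proof -
  let ?f = "case_quat_gen a b"
  have f: "?f g \<in> carrier G" for g using rel by (cases g) (auto simp: quaternion_relations_def)
  have "word_eval ?f r = word_eval ?f s" if rs: "(r, s) \<in> quat_rels n" for r s
  proof -
    have *: "word_eval ?f (replicate k (g, True)) = ?f g [^] k" for k g by (rule word_eval_replicate[OF f])
    consider "r = replicate (2 ^ (n - 2)) (Gen_a, True)" "s = replicate 2 (Gen_b, True)"
      | "r = replicate (2 ^ (n - 1)) (Gen_a, True)" "s = []"
      | "r = [(Gen_b, False), (Gen_a, True), (Gen_b, True)]" "s = [(Gen_a, False)]"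
      using rs by (auto simp: quat_rels_def)
    then show ?thesis
    proof cases
      case 1 then show ?thesis using rel by (simp only: *) (simp add: quaternion_relations_def)
    next
      case 2 then show ?thesis using rel by (simp only: *) (simp add: quaternion_relations_def)
    next
      case 3 then show ?thesis using rel by (simp add: quaternion_relations_def m_assoc[symmetric])
    qed
  qed
  then show ?thesis unfolding gen_quaternion_group_eq by (rule presented_group_hom[of ?f, OF f])
qed

section \<open>The quaternion group as a presented group\<close>

context
  fixes n :: nat
begin

interpretation Q: group "gen_quaternion_group n"
  unfolding gen_quaternion_group_eq by (rule group_presented_group)

abbreviation "quat_a \<equiv> pres_class (quat_rels n) [(Gen_a, True)]"
abbreviation "quat_b \<equiv> pres_class (quat_rels n) [(Gen_b, True)]"

lemma gen_quaternion_carrier: "carrier (gen_quaternion_group n) = range (pres_class (quat_rels n))"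
  by (simp add: gen_quaternion_group_eq presented_group_def)

lemma gen_quaternion_one: "\<one>\<^bsub>gen_quaternion_group n\<^esub> = pres_class (quat_rels n) []"
  by (simp add: gen_quaternion_group_eq presented_group_def)

lemma gen_quaternion_mult:
  "pres_class (quat_rels n) u \<otimes>\<^bsub>gen_quaternion_group n\<^esub> pres_class (quat_rels n) v = pres_class (quat_rels n) (u @ v)"
  unfolding gen_quaternion_group_eq by (rule mult_pres_class)

lemma gen_quaternion_inv:
  "inv\<^bsub>gen_quaternion_group n\<^esub> pres_class (quat_rels n) [(g, True)] = pres_class (quat_rels n) [(g, False)]"
proof (rule Q.inv_equality)
  show "pres_class (quat_rels n) [(g, False)] \<otimes>\<^bsub>gen_quaternion_group n\<^esub> pres_class (quat_rels n) [(g, True)]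
      = \<one>\<^bsub>gen_quaternion_group n\<^esub>"
    unfolding gen_quaternion_mult gen_quaternion_one pres_class_eq_iff
    using pres_cong.cancel[of "quat_rels n" "[]" g False "[]"] by simp
qed (auto simp: gen_quaternion_carrier)

text \<open>This turns the normal form of evaluated words into a normal form of all elements of the
  presented group.\<close>

lemma gen_quaternion_word:
  "Q.word_eval (case_quat_gen quat_a quat_b) w = pres_class (quat_rels n) w"
proof (induction w)
  case Nil then show ?case by (simp add: gen_quaternion_one)
next
  case (Cons l w)
  obtain g e where l: "l = (g, e)" by (cases l)
  show ?case unfolding l Q.word_eval_simps Cons
    by (cases g; cases e) (simp_all add: gen_quaternion_inv gen_quaternion_mult)
qed

lemma gen_quaternion_relations: "quaternion_relations (gen_quaternion_group n) n quat_a quat_b"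
proof -
  let ?f = "case_quat_gen quat_a quat_b"
  have f: "?f g \<in> carrier (gen_quaternion_group n)" for g
    by (cases g) (auto simp: gen_quaternion_carrier)
  have pow: "?f g [^]\<^bsub>gen_quaternion_group n\<^esub> (k::nat) = pres_class (quat_rels n) (replicate k (g, True))" for g k
    using Q.word_eval_replicate[of ?f, OF f] unfolding gen_quaternion_word by simp
  have eq: "pres_class (quat_rels n) r = pres_class (quat_rels n) s" if "(r, s) \<in> quat_rels n" for r s
    unfolding pres_class_eq_iff using pres_cong.rel[OF that, of "[]" "[]"] by simp
  show ?thesis
    unfolding quaternion_relations_def
  proof (intro conjI)
    show "quat_a [^]\<^bsub>gen_quaternion_group n\<^esub> (2 ^ (n - 2) :: nat) = quat_b [^]\<^bsub>gen_quaternion_group n\<^esub> (2::nat)"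
      using pow[of Gen_a "2 ^ (n - 2)"] pow[of Gen_b 2] eq[of "replicate (2 ^ (n - 2)) (Gen_a, True)" "replicate 2 (Gen_b, True)"]
      by (simp add: quat_rels_def)
    show "quat_a [^]\<^bsub>gen_quaternion_group n\<^esub> (2 ^ (n - 1) :: nat) = \<one>\<^bsub>gen_quaternion_group n\<^esub>"
      using pow[of Gen_a "2 ^ (n - 1)"] eq[of "replicate (2 ^ (n - 1)) (Gen_a, True)" "[]"]
      by (simp add: gen_quaternion_one) (simp add: quat_rels_def)
    show "inv\<^bsub>gen_quaternion_group n\<^esub> quat_b \<otimes>\<^bsub>gen_quaternion_group n\<^esub> quat_a \<otimes>\<^bsub>gen_quaternion_group n\<^esub> quat_b
        = inv\<^bsub>gen_quaternion_group n\<^esub> quat_a"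
      unfolding gen_quaternion_inv gen_quaternion_mult append.simps by (rule eq) (simp add: quat_rels_def)
  qed (auto simp: gen_quaternion_carrier)
qed

lemma gen_quaternion_normal_form:
  assumes "n \<ge> 3" "x \<in> carrier (gen_quaternion_group n)"
  shows "\<exists>i<2 ^ (n - 1). \<exists>s<2. x = quat_a [^]\<^bsub>gen_quaternion_group n\<^esub> (i::nat) \<otimes>\<^bsub>gen_quaternion_group n\<^esub>
    quat_b [^]\<^bsub>gen_quaternion_group n\<^esub> (s::nat)"
proof -
  obtain w where "x = pres_class (quat_rels n) w" using assms(2) gen_quaternion_carrier by blast
  then show ?thesis using Q.quaternion_normal_form[OF assms(1) gen_quaternion_relations, of w]
    unfolding gen_quaternion_word by simp
qed

lemma gen_quaternion_card:
  assumes "n \<ge> 3"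
  shows "finite (carrier (gen_quaternion_group n))" "card (carrier (gen_quaternion_group n)) \<le> 2 ^ n"
proof -
  let ?e = "\<lambda>(i::nat, s::nat). quat_a [^]\<^bsub>gen_quaternion_group n\<^esub> i \<otimes>\<^bsub>gen_quaternion_group n\<^esub>
    quat_b [^]\<^bsub>gen_quaternion_group n\<^esub> s"
  have sub: "carrier (gen_quaternion_group n) \<subseteq> ?e ` ({..<2 ^ (n - 1)} \<times> {..<2})"
    using gen_quaternion_normal_form[OF assms] by fastforce
  then show "finite (carrier (gen_quaternion_group n))" by (rule finite_subset) simp
  have "card (carrier (gen_quaternion_group n)) \<le> card ({..<2 ^ (n - 1) :: nat} \<times> {..<2::nat})"
    using sub by (intro surj_card_le) auto
  also have "\<dots> = 2 ^ n" using assms by (cases n) auto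
  finally show "card (carrier (gen_quaternion_group n)) \<le> 2 ^ n" .
qed

end

text \<open>The relations give a surjection from the presented group. \<open>G\<close> is the
  disjoint union of \<open>A\<close> and \<open>A b\<close> and has \<open>2^n\<close> elements, the
  presented group has at most as many, so the surjection is injective.\<close>

lemma (in group) is_gen_quaternionI:
  assumes fin: "finite (carrier G)"
    and a: "a \<in> carrier G" "ord a = 2 ^ m" "m \<ge> 2"
    and b: "b \<in> carrier G" "b \<notin> generate G {a}" "b \<otimes> a = inv a \<otimes> b"
      "b [^] (2::nat) = a [^] (2 ^ (m - 1) :: nat)"
    and gen: "carrier G = generate G {a} \<union> (\<lambda>x. x \<otimes> b) ` generate G {a}"
  shows "is_gen_quaternion G"
proof -
  \<comment> \<open>The relations expect \<open>a\<close> to have order \<open>2^(n-1)\<close>, here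
    \<open>2^m\<close>.\<close>
  define n where "n = Suc m"
  have n: "n \<ge> 3" using a(3) by (simp add: n_def)
  let ?A = "generate G {a}" and ?Q = "gen_quaternion_group n" and ?f = "case_quat_gen a b"
  interpret Q: group ?Q unfolding gen_quaternion_group_eq by (rule group_presented_group)
  have sA: "subgroup ?A G" using a(1) by (rule subgroup_generate)
  have "inv b \<otimes> a \<otimes> b = inv a"
  proof -
    have "inv b \<otimes> inv a \<otimes> b = inv b \<otimes> (inv a \<otimes> b)" using a b by (simp add: m_assoc)
    also have "\<dots> = a" using a(1) b(1) b(3)[symmetric] by (simp add: m_assoc[symmetric])
    finally have "inv (inv b \<otimes> inv a \<otimes> b) = inv a" by simp
    then show ?thesis using a(1) b(1) by (simp add: inv_mult_group m_assoc)
  qed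
  then have rel: "quaternion_relations G n a b"
    using a b pow_ord_eq_1[OF a(1)] by (simp add: quaternion_relations_def n_def)
  obtain h where h: "h \<in> hom ?Q G" "\<And>u. h (pres_class (quat_rels n) u) = word_eval ?f u"
    using gen_quaternion_hom[OF rel] by blast
  have "card ?A = 2 ^ m" using generate_pow_card a by simp
  have finA: "finite ?A" by (rule finite_subset[OF subgroup.subset[OF sA] fin])
  have AC: "x \<in> carrier G" if "x \<in> ?A" for x by (rule subgroup.mem_carrier[OF sA that])
  have "?A \<inter> (\<lambda>x. x \<otimes> b) ` ?A = {}"
  proof (rule ccontr)
    assume "\<not> ?thesis"
    then obtain x where x: "x \<in> ?A" "x \<otimes> b \<in> ?A" by blast
    then have "inv x \<otimes> (x \<otimes> b) \<in> ?A" using sA by (simp add: subgroup.m_closed subgroup.m_inv_closed)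
    then show False using b(1,2) AC[OF x(1)] by (simp add: m_assoc[symmetric])
  qed
  then have "card (carrier G) = card ?A + card ((\<lambda>x. x \<otimes> b) ` ?A)"
    unfolding gen using finA by (intro card_Un_disjoint) auto
  also have "card ((\<lambda>x. x \<otimes> b) ` ?A) = card ?A"
    using AC b(1) by (intro card_image inj_onI) auto
  finally have cG: "card (carrier G) = 2 ^ n" using \<open>card ?A = 2 ^ m\<close> by (simp add: n_def)
  have f: "?f g \<in> carrier G" for g using a b by (cases g) auto
  have surj: "h ` carrier ?Q = carrier G"
  proof
    show "h ` carrier ?Q \<subseteq> carrier G" using h(1) by (auto simp: hom_def)
    have img: "word_eval ?f u \<in> h ` carrier ?Q" for u
      unfolding h(2)[symmetric] by (simp add: gen_quaternion_carrier)
    show "carrier G \<subseteq> h ` carrier ?Q"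
    proof
      fix x assume "x \<in> carrier G"
      then have "\<exists>i::nat. x = a [^] i \<or> x = a [^] i \<otimes> b"
        unfolding gen generate_finite[OF fin a(1)] by auto
      then obtain i :: nat where i: "x = a [^] i \<or> x = a [^] i \<otimes> b" by blast
      have *: "word_eval ?f (replicate i (Gen_a, True)) = a [^] i"
        using word_eval_replicate[of ?f, OF f] by simp
      have **: "word_eval ?f (replicate i (Gen_a, True) @ [(Gen_b, True)]) = a [^] i \<otimes> b"
        using word_eval_append[of ?f, OF f] * b(1) by simp
      show "x \<in> h ` carrier ?Q" using i img[of "replicate i (Gen_a, True)"]
          img[of "replicate i (Gen_a, True) @ [(Gen_b, True)]"] unfolding * ** by metis
    qed
  qed
  have "inj_on h (carrier ?Q)"
  proof (rule eq_card_imp_inj_on)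
    show "finite (carrier ?Q)" by (rule gen_quaternion_card[OF n])
    then have "card (h ` carrier ?Q) \<le> card (carrier ?Q)" by (rule card_image_le)
    then show "card (h ` carrier ?Q) = card (carrier ?Q)"
      using gen_quaternion_card(2)[OF n] cG surj by simp
  qed
  then have "h \<in> iso ?Q G" using h(1) surj by (simp add: iso_def bij_betw_def)
  then have "G \<cong> ?Q" using Q.iso_sym is_isoI by blast
  then show ?thesis using n unfolding is_gen_quaternion_def by blast
qed

text \<open>The two maps below generate the faithful two-dimensional complex representation of the quaternion
  group, which is what shows that the presentation does not collapse.\<close>

definition diagonal_map :: "complex \<Rightarrow> complex \<times> complex \<Rightarrow> complex \<times> complex"
  where "diagonal_map w = (\<lambda>(x, y). (w * x, cnj w * y))"

definition quarter_turn :: "complex \<times> complex \<Rightarrow> complex \<times> complex"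
  where "quarter_turn = (\<lambda>(x, y). (- y, x))"

lemma carrier_BijGroup_UNIV: "f \<in> carrier (BijGroup UNIV) \<longleftrightarrow> bij f"
  by (simp add: BijGroup_def Bij_def)

lemma mult_BijGroup_UNIV: "bij f \<Longrightarrow> bij g \<Longrightarrow> f \<otimes>\<^bsub>BijGroup UNIV\<^esub> g = f \<circ> g"
  by (simp add: BijGroup_def Bij_def compose_def fun_eq_iff)

lemma one_BijGroup_UNIV: "\<one>\<^bsub>BijGroup UNIV\<^esub> = id"
  by (auto simp: BijGroup_def fun_eq_iff)

lemma inv_BijGroup_UNIV:
  assumes "bij f" "bij g" "g \<circ> f = id"
  shows "inv\<^bsub>BijGroup UNIV\<^esub> f = g"
  using assms by (intro group.inv_equality[OF group_BijGroup])
    (simp_all add: carrier_BijGroup_UNIV mult_BijGroup_UNIV one_BijGroup_UNIV)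

lemma diagonal_map_comp: "diagonal_map v \<circ> diagonal_map w = diagonal_map (v * w)"
  by (auto simp: diagonal_map_def)

lemma diagonal_map_1: "diagonal_map 1 = id"
  by (auto simp: diagonal_map_def)

lemma bij_diagonal_map:
  assumes "w \<noteq> 0"
  shows "bij (diagonal_map w)"
  by (rule o_bij[of "diagonal_map (inverse w)"])
    (simp_all add: diagonal_map_comp assms diagonal_map_1)

lemma bij_quarter_turn: "bij quarter_turn"
  by (rule o_bij[of "\<lambda>(x, y). (y, - x)"]) (auto simp: quarter_turn_def)

lemma diagonal_map_pow:
  assumes "w \<noteq> 0"
  shows "diagonal_map w [^]\<^bsub>BijGroup UNIV\<^esub> (k::nat) = diagonal_map (w ^ k)"
proof -
  interpret group "BijGroup (UNIV :: (complex \<times> complex) set)" by (rule group_BijGroup)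
  show ?thesis
    by (induction k) (simp_all add: one_BijGroup_UNIV diagonal_map_1 mult_BijGroup_UNIV
      bij_diagonal_map assms diagonal_map_comp mult.commute)
qed

lemma quarter_turn_square: "quarter_turn [^]\<^bsub>BijGroup UNIV\<^esub> (2::nat) = diagonal_map (- 1)"
proof -
  interpret group "BijGroup (UNIV :: (complex \<times> complex) set)" by (rule group_BijGroup)
  have "quarter_turn [^]\<^bsub>BijGroup UNIV\<^esub> (2::nat) = quarter_turn \<circ> quarter_turn"
    by (simp add: numeral_2_eq_2 one_BijGroup_UNIV mult_BijGroup_UNIV bij_quarter_turn)
  then show ?thesis by (auto simp: quarter_turn_def diagonal_map_def)
qed

text \<open>The angle is chosen so that the \<open>2^(n-2)\<close>-th power of the root of unity is
  -1, matching the square of the quarter turn. Conjugation by the quarter turn swaps the two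
  diagonal entries, which are mutually inverse.\<close>

lemma quaternion_relations_complex:
  assumes "n \<ge> 3"
  shows "quaternion_relations (BijGroup UNIV) n (diagonal_map (cis (pi / 2 ^ (n - 2)))) quarter_turn"
proof -
  define w where "w = cis (pi / 2 ^ (n - 2))"
  have w0: "w \<noteq> 0" and ww: "cnj w * w = 1" "w * cnj w = 1" and c0: "cnj w \<noteq> 0"
    by (simp_all add: w_def cis_cnj cis_mult)
  have w1: "w ^ (2 ^ (n - 2)) = - 1" by (simp add: w_def DeMoivre)
  have "n - 1 = Suc (n - 2)" using assms by simp
  then have "w ^ (2 ^ (n - 1)) = (w ^ (2 ^ (n - 2))) ^ 2" by (simp only: power_Suc2 power_mult)
  then have w2: "w ^ (2 ^ (n - 1)) = 1" using w1 by simp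
  have inv_a: "inv\<^bsub>BijGroup UNIV\<^esub> diagonal_map w = diagonal_map (cnj w)"
    by (rule inv_BijGroup_UNIV) (simp_all add: bij_diagonal_map w0 diagonal_map_comp ww diagonal_map_1)
  let ?b' = "\<lambda>(x :: complex, y :: complex). (y, - x)"
  have b': "bij ?b'" by (rule o_bij[of quarter_turn]) (auto simp: quarter_turn_def)
  have inv_b: "inv\<^bsub>BijGroup UNIV\<^esub> quarter_turn = ?b'"
    by (rule inv_BijGroup_UNIV[OF bij_quarter_turn b']) (auto simp: quarter_turn_def)
  have "?b' \<circ> diagonal_map w \<circ> quarter_turn = diagonal_map (cnj w)"
    by (auto simp: diagonal_map_def quarter_turn_def)
  then have "inv\<^bsub>BijGroup UNIV\<^esub> quarter_turn \<otimes>\<^bsub>BijGroup UNIV\<^esub> diagonal_map w \<otimes>\<^bsub>BijGroup UNIV\<^esub> quarter_turn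
    = inv\<^bsub>BijGroup UNIV\<^esub> diagonal_map w"
    unfolding inv_a inv_b
    by (simp add: mult_BijGroup_UNIV b' bij_diagonal_map w0 bij_quarter_turn bij_comp)
  then show ?thesis
    unfolding quaternion_relations_def w_def[symmetric]
    by (simp add: carrier_BijGroup_UNIV bij_diagonal_map w0 bij_quarter_turn
      diagonal_map_pow w1 w2[unfolded One_nat_def] quarter_turn_square one_BijGroup_UNIV diagonal_map_1)
qed

text \<open>Any such equality would survive in the representation, where 1, \<open>b\<close> and
  \<open>b^2\<close> send \<open>(1, 0)\<close> to \<open>(1, 0)\<close>, \<open>(0, 1)\<close> and
  \<open>(-1, 0)\<close>.\<close>

lemma gen_quaternion_nontrivial:
  assumes "n \<ge> 3"
  shows "quat_b n [^]\<^bsub>gen_quaternion_group n\<^esub> (2::nat) \<noteq> \<one>\<^bsub>gen_quaternion_group n\<^esub>"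
    "quat_b n \<noteq> \<one>\<^bsub>gen_quaternion_group n\<^esub>"
    "quat_b n \<noteq> quat_b n [^]\<^bsub>gen_quaternion_group n\<^esub> (2::nat)"
proof -
  let ?Q = "gen_quaternion_group n"
  let ?B = "BijGroup (UNIV :: (complex \<times> complex) set)"
  interpret Q: group ?Q unfolding gen_quaternion_group_eq by (rule group_presented_group)
  interpret B: group ?B by (rule group_BijGroup)
  obtain h where h: "h \<in> hom ?Q ?B" "\<And>u. h (pres_class (quat_rels n) u) =
    B.word_eval (case_quat_gen (diagonal_map (cis (pi / 2 ^ (n - 2)))) quarter_turn) u"
    using B.gen_quaternion_hom[OF quaternion_relations_complex[OF assms]] by blast
  interpret h: group_hom ?Q ?B h using h(1) by unfold_locales
  have hb: "h (quat_b n) = quarter_turn"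
    unfolding h(2) using bij_quarter_turn by (simp add: carrier_BijGroup_UNIV)
  have bQ: "quat_b n \<in> carrier ?Q" by (simp add: gen_quaternion_carrier)
  have h2: "h (quat_b n [^]\<^bsub>?Q\<^esub> (2::nat)) = diagonal_map (- 1)"
    using h.hom_nat_pow[OF bQ] hb quarter_turn_square by simp
  have h1: "h \<one>\<^bsub>?Q\<^esub> = id" using h.hom_one one_BijGroup_UNIV by simp
  have "diagonal_map (- 1) (1, 0) \<noteq> id (1, 0)" "quarter_turn (1, 0) \<noteq> id (1, 0)"
    "quarter_turn (1, 0) \<noteq> diagonal_map (- 1) (1, 0)"
    by (simp_all add: diagonal_map_def quarter_turn_def)
  then show "quat_b n [^]\<^bsub>?Q\<^esub> (2::nat) \<noteq> \<one>\<^bsub>?Q\<^esub>" "quat_b n \<noteq> \<one>\<^bsub>?Q\<^esub>"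
    "quat_b n \<noteq> quat_b n [^]\<^bsub>?Q\<^esub> (2::nat)"
    using h1 h2 hb by metis+
qed

text \<open>The subgroup generated by \<open>b^2\<close> will be the breaking point; the first
  inequality makes it nontrivial, the other two keep \<open>b\<close> out of it.\<close>

lemma is_gen_quaternionE:
  fixes G (structure)
  assumes "group G" "is_gen_quaternion G"
  obtains n a b where "n \<ge> 3" "quaternion_relations G n a b"
    "b [^]\<^bsub>G\<^esub> (2::nat) \<noteq> \<one>\<^bsub>G\<^esub>" "b \<noteq> \<one>\<^bsub>G\<^esub>" "b \<noteq> b [^]\<^bsub>G\<^esub> (2::nat)"
    "\<And>x. x \<in> carrier G \<Longrightarrow> \<exists>i s. s < 2 \<and> x = a [^]\<^bsub>G\<^esub> (i::nat) \<otimes>\<^bsub>G\<^esub> b [^]\<^bsub>G\<^esub> (s::nat)"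
proof -
  interpret group G by fact
  obtain n where n: "n \<ge> 3" "G \<cong> gen_quaternion_group n" using assms(2) unfolding is_gen_quaternion_def by blast
  let ?Q = "gen_quaternion_group n"
  interpret Q: group ?Q unfolding gen_quaternion_group_eq by (rule group_presented_group)
  obtain h where h: "h \<in> iso ?Q G" using iso_sym[OF n(2)] by (auto simp: is_iso_def)
  interpret h: group_hom ?Q G h using h by unfold_locales (simp add: iso_def)
  have inj: "inj_on h (carrier ?Q)" and surj: "h ` carrier ?Q = carrier G"
    using h by (auto simp: iso_def bij_betw_def)
  have ab: "quat_a n \<in> carrier ?Q" "quat_b n \<in> carrier ?Q" by (simp_all add: gen_quaternion_carrier)
  show ?thesis
  proof (rule that[of n "h (quat_a n)" "h (quat_b n)"])
    show "n \<ge> 3" by fact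
    show "quaternion_relations G n (h (quat_a n)) (h (quat_b n))"
      using gen_quaternion_relations[of n] ab unfolding quaternion_relations_def
      by (simp flip: h.hom_nat_pow h.hom_inv h.hom_mult)
    show "h (quat_b n) [^] (2::nat) \<noteq> \<one>" "h (quat_b n) \<noteq> \<one>" "h (quat_b n) \<noteq> h (quat_b n) [^] (2::nat)"
      using gen_quaternion_nontrivial[OF n(1)] ab inj
      unfolding h.hom_nat_pow[OF ab(2), symmetric] h.hom_one[symmetric]
      by (auto dest: inj_onD simp del: h.hom_one h.hom_nat_pow)
    fix x assume "x \<in> carrier G"
    then obtain y where y: "y \<in> carrier ?Q" "x = h y" using surj by blast
    obtain i s :: nat where "s < 2" "y = quat_a n [^]\<^bsub>?Q\<^esub> i \<otimes>\<^bsub>?Q\<^esub> quat_b n [^]\<^bsub>?Q\<^esub> s"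
      using gen_quaternion_normal_form[OF n(1) y(1)] by blast
    then show "\<exists>i s. s < 2 \<and> x = h (quat_a n) [^] (i::nat) \<otimes> h (quat_b n) [^] (s::nat)"
      using ab y(2) by (intro exI[of _ i] exI[of _ s]) (simp add: h.hom_nat_pow)
  qed
qed

section \<open>Breaking points\<close>

text \<open>\<open>subgroup_conj_class G H\<close> is comparable to every element of the poset, stated on representatives.\<close>

definition comparable_to_all :: "('a, 'b) monoid_scheme \<Rightarrow> 'a set \<Rightarrow> bool"
  where "comparable_to_all G H \<longleftrightarrow> (\<forall>X. subgroup X G \<longrightarrow>
    (\<exists>x \<in> carrier G. X \<subseteq> conj_subgroup G H x) \<or> (\<exists>x \<in> carrier G. H \<subseteq> conj_subgroup G X x))"

section \<open>From a breaking point to a unique subgroup of order p\<close>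

context group
begin

lemma ex_breaking_point_iff:
  "(\<exists>C. breaking_point G C) \<longleftrightarrow>
    (\<exists>H. subgroup H G \<and> H \<noteq> {\<one>} \<and> H \<noteq> carrier G \<and> comparable_to_all G H)"
proof -
  have *: "(\<forall>X \<in> carrier (subgroup_class_poset G).
       X \<sqsubseteq>\<^bsub>subgroup_class_poset G\<^esub> subgroup_conj_class G H \<or>
       subgroup_conj_class G H \<sqsubseteq>\<^bsub>subgroup_class_poset G\<^esub> X) \<longleftrightarrow> comparable_to_all G H"
    if H: "subgroup H G" for H
  proof -
    have c: "carrier (subgroup_class_poset G) = {subgroup_conj_class G X | X. subgroup X G}"
      by (simp add: subgroup_class_poset_def)
    show ?thesis
      unfolding c comparable_to_all_def
      using le_subgroup_class_poset_iff[OF is_group _ H] le_subgroup_class_poset_iff[OF is_group H]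
      by blast
  qed
  show ?thesis unfolding breaking_point_def using * by blast
qed

lemma r_inv_cancel: "x \<in> carrier G \<Longrightarrow> y \<in> carrier G \<Longrightarrow> x \<otimes> (inv x \<otimes> y) = y"
  by (simp add: m_assoc[symmetric])

lemma subgroup_conj_subgroup:
  assumes "subgroup H G" "x \<in> carrier G"
  shows "subgroup (conj_subgroup G H x) G"
proof -
  have "conj_subgroup G H x = inv x <# H #> x"
    by (auto simp: conj_subgroup_def l_coset_def r_coset_def)
  then show ?thesis using subgroup_conjugation_is_surj1 assms by simp
qed

lemma card_dvd_of_subset_conj:
  assumes "subgroup H G" "subgroup K G" "x \<in> carrier G" "H \<subseteq> conj_subgroup G K x"
  shows "card H dvd card K"
  using card_subgroup_dvd[OF assms(1) subgroup_conj_subgroup[OF assms(2,3)] assms(4)]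
    card_conj_subgroup[OF is_group subgroup.subset[OF assms(2)] assms(3)] by simp

lemma conj_subgroup_self:
  assumes "subgroup H G" "h \<in> H"
  shows "conj_subgroup G H h = H"
proof -
  have hc: "h \<in> carrier G" by (rule subgroup.mem_carrier[OF assms])
  have HC: "y \<in> carrier G" if "y \<in> H" for y by (rule subgroup.mem_carrier[OF assms(1) that])
  have "y \<in> conj_subgroup G H h" if y: "y \<in> H" for y
    unfolding conj_subgroup_def
  proof (rule image_eqI)
    show "y = inv h \<otimes> (h \<otimes> y \<otimes> inv h) \<otimes> h"
      using hc HC[OF y] conjugation_is_surj[of "inv h" y] by simp
    show "h \<otimes> y \<otimes> inv h \<in> H" using assms y by (simp add: subgroup.m_closed subgroup.m_inv_closed)
  qed
  moreover have "conj_subgroup G H h \<subseteq> H"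
    using assms by (auto simp: conj_subgroup_def subgroup.m_closed subgroup.m_inv_closed)
  ultimately show ?thesis by blast
qed

text \<open>There are at most as many conjugates of \<open>H\<close> as cosets, and all of them share the identity.\<close>

lemma not_covered_by_conjugates:
  assumes fin: "finite (carrier G)" and H: "subgroup H G" "H \<noteq> carrier G"
  obtains g where "g \<in> carrier G" "\<And>x. x \<in> carrier G \<Longrightarrow> g \<notin> conj_subgroup G H x"
proof -
  have Hsub: "H \<subseteq> carrier G" by (rule subgroup.subset[OF H(1)])
  have finH: "finite H" by (rule finite_subset[OF Hsub fin])
  have one: "\<one> \<in> H" by (rule subgroup.one_closed[OF H(1)])
  \<comment> \<open>As \<open>h x\<close> and \<open>x\<close> conjugate \<open>H\<close> to the
    same subgroup for \<open>h\<close> in \<open>H\<close>, the conjugates can be indexed by right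
    cosets, with any representative; the shared identity is removed.\<close>
  define f where "f R = conj_subgroup G H (SOME y. y \<in> R) - {\<one>}" for R
  have f: "conj_subgroup G H x - {\<one>} = f (H #> x)" if x: "x \<in> carrier G" for x
  proof -
    have "x \<in> H #> x" by (rule rcos_self[OF x H(1)])
    then have "(SOME y. y \<in> H #> x) \<in> H #> x" by (rule someI)
    then obtain h where h: "h \<in> H" "(SOME y. y \<in> H #> x) = h \<otimes> x" by (auto simp: r_coset_def)
    have "conj_subgroup G H (h \<otimes> x) = conj_subgroup G H x"
      using conj_subgroup_mult[OF is_group Hsub _ x, of h] conj_subgroup_self[OF H(1) h(1)]
        subgroup.mem_carrier[OF H(1) h(1)] by simp
    then show ?thesis unfolding f_def h(2) by simp
  qed
  have cardf: "card (f R) \<le> card H - 1" if R: "R \<in> rcosets H" for R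
  proof -
    obtain x where x: "x \<in> carrier G" "R = H #> x" using R by (auto simp: RCOSETS_def)
    have "card (conj_subgroup G H x) = card H" by (rule card_conj_subgroup[OF is_group Hsub x(1)])
    moreover have "\<one> \<in> conj_subgroup G H x"
      by (rule subgroup.one_closed[OF subgroup_conj_subgroup[OF H(1) x(1)]])
    ultimately show ?thesis unfolding x(2) f[OF x(1), symmetric] by simp
  qed
  have lag: "card (rcosets H) * card H = card (carrier G)"
    using lagrange[OF H(1)] by (simp add: order_def)
  have finR: "finite (rcosets H)" using fin by (auto simp: RCOSETS_def)
  have "card (\<Union>R\<in>rcosets H. f R) \<le> (\<Sum>R\<in>rcosets H. card (f R))" by (rule card_UN_le[OF finR])
  also have "\<dots> \<le> card (rcosets H) * (card H - 1)"
    using sum_bounded_above[of "rcosets H" "\<lambda>R. card (f R)" "card H - 1"] cardf by simp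
  also have "\<dots> = card (carrier G) - card (rcosets H)"
    using lag by (simp add: diff_mult_distrib2)
  finally have le: "card (\<Union>R\<in>rcosets H. f R) \<le> card (carrier G) - card (rcosets H)" .
  \<comment> \<open>With index \<open>d\<close> the bound is \<open>d (|H| - 1) = |G| - d\<close>.
    Since \<open>H\<close> is proper, \<open>d > 1\<close>, so the \<open>|G| - 1\<close> nontrivial
    elements are not exhausted.\<close>
  have "card H < card (carrier G)" using psubset_card_mono[OF fin, of H] Hsub H(2) by blast
  then have "card (rcosets H) \<noteq> 1" "card (rcosets H) \<noteq> 0"
    by (metis lag mult_1 less_irrefl, metis lag mult_0 not_less_zero)
  moreover have "card (rcosets H) \<le> card (carrier G)"
    unfolding lag[symmetric] using finH one by (auto simp: card_gt_0_iff Suc_le_eq)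
  ultimately have "card (\<Union>R\<in>rcosets H. f R) < card (carrier G) - 1" using le by linarith
  then have "\<not> carrier G - {\<one>} \<subseteq> (\<Union>R\<in>rcosets H. f R)"
  proof -
    have "finite (\<Union>R\<in>rcosets H. f R)"
    proof (intro finite_UN_I finR)
      fix R assume "R \<in> rcosets H"
      then obtain x where x: "x \<in> carrier G" "R = H #> x" by (auto simp: RCOSETS_def)
      show "finite (f R)" unfolding x(2) f[OF x(1), symmetric] using finH by (simp add: conj_subgroup_def)
    qed
    moreover have "card (carrier G - {\<one>}) = card (carrier G) - 1" by (simp add: fin)
    ultimately show ?thesis using \<open>card (\<Union>R\<in>rcosets H. f R) < card (carrier G) - 1\<close> card_mono by (metis not_le)
  qed
  then obtain g where g: "g \<in> carrier G" "g \<noteq> \<one>" "g \<notin> (\<Union>R\<in>rcosets H. f R)" by blast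
  have "g \<notin> conj_subgroup G H x" if x: "x \<in> carrier G" for x
  proof
    assume "g \<in> conj_subgroup G H x"
    then have "g \<in> f (H #> x)" using g(2) f[OF x] by blast
    moreover have "H #> x \<in> rcosets H" using x by (auto simp: RCOSETS_def)
    ultimately show False using g(3) by blast
  qed
  then show ?thesis using that g(1) by blast
qed

text \<open>For each prime \<open>q\<close>, the \<open>q\<close>-part of \<open>|G|\<close> divides
  \<open>|H|\<close> or is divisible by it. If the former held for all \<open>q\<close>, then
  \<open>|G|\<close> would divide \<open>|H|\<close>; so \<open>|H|\<close> is a power of some prime
  \<open>r\<close>. For any other prime divisor of \<open>|G|\<close> both alternatives now fail,
  because \<open>H\<close> is a nontrivial \<open>r\<close>-group.\<close>

lemma comparable_prime_power:
  assumes fin: "finite (carrier G)"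
    and H: "subgroup H G" "H \<noteq> {\<one>}" "H \<noteq> carrier G" "comparable_to_all G H"
  obtains p k where "prime p" "order G = p ^ k"
proof -
  define n where "n = order G"
  have n0: "n > 0" using fin by (simp add: n_def order_gt_0_iff_finite)
  have finH: "finite H" by (rule finite_subset[OF subgroup.subset[OF H(1)] fin])
  have H0: "card H > 0" using subgroup.one_closed[OF H(1)] finH card_gt_0_iff by blast
  have H1: "card H \<noteq> 1" using subgroup_eq_one_iff[OF fin H(1)] H(2) by simp
  have sylow: "\<exists>R. subgroup R G \<and> card R = q ^ multiplicity q n" if "prime q" for q
    using sylow_thm[OF that is_group _ fin, of "multiplicity q n" "n div q ^ multiplicity q n"]
    by (simp add: n_def multiplicity_dvd)
  have cmp: "q ^ multiplicity q n dvd card H \<or> card H dvd q ^ multiplicity q n" if q: "prime q" for q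
  proof -
    obtain R where R: "subgroup R G" "card R = q ^ multiplicity q n" using sylow[OF q] by blast
    then show ?thesis
      using H(4) card_dvd_of_subset_conj[OF R(1) H(1)] card_dvd_of_subset_conj[OF H(1) R(1)]
      unfolding comparable_to_all_def by metis
  qed
  have "\<exists>r. prime r \<and> card H dvd r ^ multiplicity r n"
  proof (rule ccontr)
    assume "\<not> ?thesis"
    then have "r ^ multiplicity r n dvd card H" if "prime r" for r using cmp that by blast
    then have "multiplicity r n \<le> multiplicity r (card H)" if "prime r" for r
      using that H0 by (intro multiplicity_geI) (auto simp: prime_gt_1_nat)
    then have "n dvd card H" using n0 by (intro multiplicity_le_imp_dvd) auto
    then have "card (carrier G) \<le> card H" using H0 by (simp add: n_def order_def dvd_imp_le)
    then have "H = carrier G" by (rule card_seteq[OF fin subgroup.subset[OF H(1)]])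
    then show False using H(3) by blast
  qed
  then obtain r where r: "prime r" "card H dvd r ^ multiplicity r n" by blast
  then obtain j where j: "card H = r ^ j" using divides_primepow_nat by blast
  then have rH: "r dvd card H" using H1 by (cases j) auto
  have only: "q = r" if q: "prime q" "q dvd n" for q
    using cmp[OF q(1)]
  proof
    assume "q ^ multiplicity q n dvd card H"
    moreover have "q dvd q ^ multiplicity q n"
      using q n0 by (intro dvd_power) (simp add: prime_multiplicity_gt_zero_iff)
    ultimately have "q dvd r ^ j" using j dvd_trans by metis
    then show ?thesis using q(1) r(1) by (metis prime_dvd_power primes_dvd_imp_eq)
  next
    assume "card H dvd q ^ multiplicity q n"
    then have "r dvd q ^ multiplicity q n" using rH dvd_trans by blast
    then show ?thesis using q(1) r(1) by (metis prime_dvd_power primes_dvd_imp_eq)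
  qed
  obtain m where m: "n = r ^ multiplicity r n * m" "\<not> r dvd m"
    using multiplicity_decompose'[of n r] n0 r(1) by (metis not_prime_unit less_irrefl)
  have "m = 1"
  proof (rule ccontr)
    assume "m \<noteq> 1"
    then obtain q where q: "prime q" "q dvd m" using prime_factor_nat by blast
    then have "q dvd n" using m(1) by (metis dvd_mult)
    then show False using only[OF q(1)] q(2) m(2) by blast
  qed
  then show ?thesis using that r(1) m(1) n_def by simp
qed

lemma comparable_unique_prime_subgroup:
  assumes fin: "finite (carrier G)" and p: "prime p" "order G = p ^ k"
    and H: "subgroup H G" "H \<noteq> {\<one>}" "H \<noteq> carrier G" "comparable_to_all G H"
  obtains c where "c \<in> carrier G" "ord c = p"
    "\<And>w. w \<in> carrier G \<Longrightarrow> w [^] p = \<one> \<Longrightarrow> w \<in> generate G {c}"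
proof -
  obtain g where g: "g \<in> carrier G" "\<And>x. x \<in> carrier G \<Longrightarrow> g \<notin> conj_subgroup G H x"
    using not_covered_by_conjugates[OF fin H(1,3)] by blast
  have gg: "generate G {g} \<subseteq> carrier G" by (rule subgroup.subset[OF subgroup_generate[OF g(1)]])
  obtain x where x: "x \<in> carrier G" "H \<subseteq> conj_subgroup G (generate G {g}) x"
    using H(4) subgroup_generate[OF g(1)] g(2) self_mem_generate[of g]
    unfolding comparable_to_all_def by blast
  \<comment> \<open>Conjugating the generator as well places \<open>H\<close> itself, and not merely
    a conjugate, inside a cyclic group.\<close>
  define y where "y = inv x \<otimes> g \<otimes> x"
  have y: "y \<in> carrier G" using x g by (simp add: y_def)
  have conj_pow: "inv u \<otimes> v [^] (i::nat) \<otimes> u = (inv u \<otimes> v \<otimes> u) [^] i"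
    if "u \<in> carrier G" "v \<in> carrier G" for u v i
  proof (induction i)
    case 0 then show ?case using that by simp
  next
    case (Suc i)
    have "inv u \<otimes> v [^] Suc i \<otimes> u = (inv u \<otimes> v [^] i \<otimes> u) \<otimes> (inv u \<otimes> v \<otimes> u)"
      using that r_inv_cancel[of u] by (simp add: m_assoc)
    then show ?case using Suc by simp
  qed
  have Hy: "H \<subseteq> generate G {y}"
  proof
    fix h assume "h \<in> H"
    then obtain i :: nat where "h = inv x \<otimes> g [^] i \<otimes> x"
      using x(2) generate_finite[OF fin g(1)] unfolding conj_subgroup_def by auto
    then show "h \<in> generate G {y}"
      using conj_pow[OF x(1) g(1)] pow_mem_generate[OF y] by (simp add: y_def)
  qed
  obtain h0 where "h0 \<in> H" "h0 \<noteq> \<one>" using H(2) subgroup.one_closed[OF H(1)] by blast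
  then have "y \<noteq> \<one>" using Hy generate_one by fastforce
  then obtain m where m: "ord (y [^] (p ^ m :: nat)) = p" "ord y = p ^ Suc m"
    using exists_element_of_prime_order[OF p(1) fin y _ p(2)] by blast
  define z where "z = y [^] (p ^ m :: nat)"
  have z: "z \<in> carrier G" "ord z = p" using y m by (simp_all add: z_def)
  have rootz: "v \<in> generate G {z}" if "v \<in> generate G {y}" "v [^] p = \<one>" for v
    unfolding z_def by (rule prime_root_in_generate[OF fin y p(1) m(2) that])
  \<comment> \<open>Comparing \<open>H\<close> with the group generated by \<open>w\<close>, either
    \<open>w\<close> is conjugate into \<open>H\<close>, so into the \<open>p\<close>-torsion of the
    cyclic group of \<open>y\<close>; or \<open>H\<close> embeds into a conjugate of the group of
    order \<open>p\<close>, and the nontrivial \<open>h0\<close> identifies that conjugate with the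
    group of \<open>z\<close>.\<close>
  have conj_root: "\<exists>u \<in> carrier G. inv u \<otimes> w \<otimes> u \<in> generate G {z}"
    if w: "w \<in> carrier G" "w [^] p = \<one>" for w
  proof (cases "w = \<one>")
    case True
    then have "inv \<one> \<otimes> w \<otimes> \<one> \<in> generate G {z}" by (simp add: generate.one)
    then show ?thesis by blast
  next
    case False
    from H(4) subgroup_generate[OF w(1)]
    have "(\<exists>u \<in> carrier G. generate G {w} \<subseteq> conj_subgroup G H u) \<or>
      (\<exists>u \<in> carrier G. H \<subseteq> conj_subgroup G (generate G {w}) u)"
      unfolding comparable_to_all_def by blast
    then show ?thesis
    proof
      assume "\<exists>u \<in> carrier G. generate G {w} \<subseteq> conj_subgroup G H u"
      then obtain u where u: "u \<in> carrier G" "w \<in> conj_subgroup G H u" using self_mem_generate[of w] by blast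
      then obtain h where h: "h \<in> H" "w = inv u \<otimes> h \<otimes> u" by (auto simp: conj_subgroup_def)
      have hc: "h \<in> carrier G" by (rule subgroup.mem_carrier[OF H(1) h(1)])
      have e: "inv (inv u) \<otimes> w \<otimes> inv u = h"
        unfolding h(2) using conjugation_is_surj[OF u(1) hc] u(1) by simp
      then have "h [^] p = inv (inv u) \<otimes> w [^] p \<otimes> inv u"
        using conj_pow[of "inv u" w p] u(1) w(1) by simp
      also have "\<dots> = \<one>" using w(2) u(1) by simp
      finally have "h \<in> generate G {z}" using rootz Hy h(1) by blast
      then show ?thesis using e u(1) by (intro bexI[of _ "inv u"]) auto
    next
      assume "\<exists>u \<in> carrier G. H \<subseteq> conj_subgroup G (generate G {w}) u"
      then obtain u where u: "u \<in> carrier G" "H \<subseteq> conj_subgroup G (generate G {w}) u" by blast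
      define w' where "w' = inv u \<otimes> w \<otimes> u"
      have w': "w' \<in> carrier G" "w' [^] p = \<one>"
        using u(1) w conj_pow[OF u(1) w(1), of p] by (simp_all add: w'_def)
      have "w' \<noteq> \<one>"
      proof
        assume "w' = \<one>"
        then have "w = \<one>" using u(1) w(1) unfolding w'_def
          by (metis conjugation_is_surj inv_closed inv_inv one_closed r_one r_inv)
        then show False using False by blast
      qed
      have "ord w' dvd p" using w' pow_eq_id by blast
      then have ow: "ord w' = p" using p(1) \<open>w' \<noteq> \<one>\<close> w'(1) ord_eq_1 prime_nat_iff by metis
      obtain i :: nat where "h0 = inv u \<otimes> w [^] i \<otimes> u"
        using u(2) \<open>h0 \<in> H\<close> generate_finite[OF fin w(1)] unfolding conj_subgroup_def by auto
      then have "h0 = w' [^] i" using conj_pow[OF u(1) w(1)] by (simp add: w'_def)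
      then have h0w: "h0 \<in> generate G {w'}" using pow_mem_generate[OF w'(1)] by simp
      then have "h0 [^] p = \<one>" using \<open>h0 = w' [^] i\<close> w' by (metis nat_pow_pow mult.commute nat_pow_one)
      then have h0z: "h0 \<in> generate G {z}" using rootz Hy \<open>h0 \<in> H\<close> by blast
      have "generate G {w'} = generate G {z}"
        using generate_prime_order[OF fin w'(1) p(1) ow h0w \<open>h0 \<noteq> \<one>\<close>]
          generate_prime_order[OF fin z(1) p(1) z(2) h0z \<open>h0 \<noteq> \<one>\<close>] by simp
      then have "w' \<in> generate G {z}" using self_mem_generate[of w'] by simp
      then show ?thesis using u(1) unfolding w'_def by blast
    qed
  qed
  \<comment> \<open>Taking the whole group as the normal subgroup yields a nontrivial central
    element.\<close>
  have "carrier G \<noteq> {\<one>}" using y \<open>y \<noteq> \<one>\<close> by blast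
  then obtain c0 where c0: "c0 \<in> carrier G" "c0 \<noteq> \<one>" "\<And>g. g \<in> carrier G \<Longrightarrow> g \<otimes> c0 = c0 \<otimes> g"
    using center_meets_normal[OF fin p, of "carrier G"] normal_self by blast
  obtain j where j: "ord (c0 [^] (p ^ j :: nat)) = p"
    using exists_element_of_prime_order[OF p(1) fin c0(1,2) p(2)] by blast
  define c where "c = c0 [^] (p ^ j :: nat)"
  have c: "c \<in> carrier G" "ord c = p" using c0 j by (simp_all add: c_def)
  have central: "v \<otimes> u = u \<otimes> v" if u: "u \<in> carrier G" and v: "v \<in> generate G {c}" for u v
  proof -
    obtain i :: nat where i: "v = c [^] i" using v generate_finite[OF fin c(1)] by auto
    have "u \<otimes> c0 = c0 [^] (1::nat) \<otimes> u" using c0 u by simp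
    from twist_pow[OF c0(1) u this, of "p ^ j * i"] show ?thesis
      using i c0(1) by (simp add: c_def nat_pow_pow)
  qed
  have "c \<noteq> \<one>" using c(2) p(1) by (metis ord_id not_prime_1)
  have "c [^] p = \<one>" using c by (metis pow_ord_eq_1)
  then obtain u where u: "u \<in> carrier G" "inv u \<otimes> c \<otimes> u \<in> generate G {z}" using conj_root c(1) by blast
  moreover have "inv u \<otimes> c \<otimes> u = c"
    using central[OF u(1) self_mem_generate] u(1) c(1) by (simp add: m_assoc) (simp add: m_assoc[symmetric])
  ultimately have "c \<in> generate G {z}" by simp
  then have cz: "generate G {z} = generate G {c}"
    using generate_prime_order[OF fin z(1) p(1) z(2) _ \<open>c \<noteq> \<one>\<close>] by simp
  show ?thesis
  proof (rule that[OF c])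
    \<comment> \<open>Some conjugate of \<open>w\<close> lies in the central subgroup generated by
      \<open>c\<close>; conjugating back leaves it unchanged.\<close>
    fix w assume w: "w \<in> carrier G" "w [^] p = \<one>"
    obtain u where u: "u \<in> carrier G" "inv u \<otimes> w \<otimes> u \<in> generate G {c}"
      using conj_root[OF w] cz by auto
    let ?v = "inv u \<otimes> w \<otimes> u"
    have "w = u \<otimes> ?v \<otimes> inv u" using u(1) w(1) by (simp add: conjugation_is_surj)
    also have "u \<otimes> ?v = ?v \<otimes> u" using central[OF u] by simp
    also have "?v \<otimes> u \<otimes> inv u = ?v" using u(1) w(1) by (simp add: m_assoc)
    finally show "w \<in> generate G {c}" using u(2) by simp
  qed
qed

end

section \<open>Constructing breaking points, and the classification\<close>

context group
begin

text \<open>Every nontrivial subgroup contains \<open>z\<close>, hence the group it generates, so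
  all comparisons succeed with the identity as conjugating element.\<close>

lemma ex_breaking_pointI:
  assumes "z \<in> carrier G" "z \<noteq> \<one>" "generate G {z} \<noteq> carrier G"
    and z: "\<And>w. w \<in> carrier G \<Longrightarrow> w \<noteq> \<one> \<Longrightarrow> z \<in> generate G {w}"
  shows "\<exists>C. breaking_point G C"
proof -
  have sz: "subgroup (generate G {z}) G" by (rule subgroup_generate[OF assms(1)])
  have "X \<subseteq> conj_subgroup G (generate G {z}) \<one> \<or> generate G {z} \<subseteq> conj_subgroup G X \<one>"
    if X: "subgroup X G" for X
  proof (cases "X = {\<one>}")
    case True
    then show ?thesis using conj_subgroup_one[OF is_group subgroup.subset[OF sz]]
        subgroup.one_closed[OF sz] by simp
  next
    case False
    then obtain w where w: "w \<in> X" "w \<noteq> \<one>" using subgroup.one_closed[OF X] by blast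
    have "z \<in> generate G {w}" using z w subgroup.mem_carrier[OF X] by blast
    then have "z \<in> X" using generate_subset_subgroup[OF X w(1)] by blast
    then show ?thesis using conj_subgroup_one[OF is_group subgroup.subset[OF X]]
        generate_subset_subgroup[OF X] by simp
  qed
  then have "comparable_to_all G (generate G {z})" unfolding comparable_to_all_def by blast
  moreover have "generate G {z} \<noteq> {\<one>}" using self_mem_generate[of z] assms(2) by auto
  ultimately show ?thesis using ex_breaking_point_iff sz assms(3) by blast
qed

lemma cyclic_group_iff_generate:
  "cyclic_group G \<longleftrightarrow> (\<exists>a \<in> carrier G. carrier G = generate G {a})"
proof -
  have "generate G {a} = range (\<lambda>n::int. a [^] n)" if "a \<in> carrier G" for a
    using generate_pow[OF that] by auto
  then show ?thesis unfolding cyclic_group by auto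
qed

text \<open>Each nontrivial subgroup has an element of order \<open>p\<close>, and a cyclic
  \<open>p\<close>-group has only one subgroup of that order; \<open>p^2 <= |G|\<close> makes it
  proper.\<close>

lemma cyclic_prime_power_ex_breaking_point:
  assumes fin: "finite (carrier G)" and "cyclic_group G" and p: "prime p" "order G = p ^ k" "p\<^sup>2 \<le> order G"
  shows "\<exists>C. breaking_point G C"
proof -
  obtain a where a: "a \<in> carrier G" "carrier G = generate G {a}"
    using assms(2) cyclic_group_iff_generate by blast
  have "p ^ 2 \<le> p ^ k" using p by simp
  then have "2 \<le> k" using p(1) by (metis power_le_imp_le_exp prime_gt_1_nat)
  then obtain m where m: "k = Suc m" "m \<noteq> 0" by (cases k) auto
  have oa: "ord a = p ^ Suc m" using generate_pow_card[OF a(1)] a(2) p(2) m(1) by (simp add: order_def)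
  define z where "z = a [^] (p ^ m :: nat)"
  have "ord z = ord a div p ^ m" unfolding z_def
    using oa p(1) a(1) by (intro ord_pow) (auto simp: prime_gt_0_nat)
  then have z: "z \<in> carrier G" "ord z = p" using a(1) oa p(1) by (auto simp: z_def prime_gt_0_nat)
  show ?thesis
  proof (rule ex_breaking_pointI[OF z(1)])
    show "z \<noteq> \<one>" using z(2) p(1) by (metis ord_id not_prime_1)
    show "generate G {z} \<noteq> carrier G"
    proof
      assume "generate G {z} = carrier G"
      then have "p = p ^ Suc m" using generate_pow_card[OF z(1)] z(2) p(2) m(1) by (simp add: order_def)
      then show False using m(2) p(1) by (metis power_inject_exp power_one_right prime_gt_1_nat One_nat_def Suc_inject)
    qed
    fix w assume w: "w \<in> carrier G" "w \<noteq> \<one>"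
    obtain j where j: "ord (w [^] (p ^ j :: nat)) = p"
      using exists_element_of_prime_order[OF p(1) fin w p(2)] by blast
    define v where "v = w [^] (p ^ j :: nat)"
    have v: "v \<in> carrier G" "ord v = p" using w j by (simp_all add: v_def)
    have v1: "v [^] p = \<one>" "v \<noteq> \<one>" using v p(1) by (metis pow_ord_eq_1, metis ord_id not_prime_1)
    have "v \<in> generate G {z}" unfolding z_def
      using prime_root_in_generate[OF fin a(1) p(1) oa _ v1(1)] v(1) a(2) by simp
    then have "generate G {v} = generate G {z}"
      using generate_prime_order[OF fin z(1) p(1) z(2) _ v1(2)] by simp
    moreover have "generate G {v} \<subseteq> generate G {w}"
      unfolding v_def by (intro generate_subset_subgroup subgroup_generate pow_mem_generate w(1))
    ultimately show "z \<in> generate G {w}" using self_mem_generate[of z] by blast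
  qed
qed

text \<open>Every nontrivial element has \<open>z = b^2\<close> among its powers: repeated squaring
  reaches \<open>z\<close> from a power of \<open>a\<close>, and each \<open>a^i b\<close> squares
  to \<open>z\<close>.\<close>

lemma gen_quaternion_ex_breaking_point:
  assumes fin: "finite (carrier G)" and Q: "is_gen_quaternion G"
  shows "\<exists>C. breaking_point G C"
proof -
  obtain n a b where n: "n \<ge> 3" and rel: "quaternion_relations G n a b"
    and b: "b [^] (2::nat) \<noteq> \<one>" "b \<noteq> \<one>" "b \<noteq> b [^] (2::nat)"
    and form: "\<And>x. x \<in> carrier G \<Longrightarrow> \<exists>i s. s < 2 \<and> x = a [^] (i::nat) \<otimes> b [^] (s::nat)"
    using is_gen_quaternionE[OF is_group Q] by blast
  define M :: nat where "M = 2 ^ (n - 1)"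
  obtain l where l: "n = Suc (Suc l)" using n by (metis Suc_le_D numeral_3_eq_3 Suc_le_mono)
  have ac: "a \<in> carrier G" and bc: "b \<in> carrier G" and zl: "a [^] (2 ^ l :: nat) = b [^] (2::nat)"
    and aM: "a [^] M = \<one>"
    using rel l by (auto simp: quaternion_relations_def M_def)
  have M: "M = 2 * 2 ^ l" using l by (simp add: M_def)
  define z where "z = b [^] (2::nat)"
  have z: "z \<in> carrier G" "z \<noteq> \<one>" using b bc by (simp_all add: z_def)
  have "z [^] (2::nat) = a [^] M" unfolding z_def zl[symmetric] M using ac by (simp add: nat_pow_pow mult.commute)
  then have z2: "z [^] (2::nat) = \<one>" using aM by simp
  have zpow: "z [^] (i::nat) = (if even i then \<one> else z)" for i
  proof (cases "even i")
    case True
    then obtain h where "i = 2 * h" by (elim evenE)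
    then have "z [^] i = (z [^] (2::nat)) [^] h" using z(1) by (simp add: nat_pow_pow)
    then show ?thesis using True z2 by simp
  next
    case False
    then obtain h where h: "i = 2 * h + 1" by (elim oddE)
    have "z [^] (2 * h + 1) = (z [^] (2::nat)) [^] h \<otimes> z" using z(1) by (simp add: nat_pow_pow)
    then show ?thesis using False z2 z(1) h by simp
  qed
  show ?thesis
  proof (rule ex_breaking_pointI[OF z])
    show "generate G {z} \<noteq> carrier G"
    proof
      assume "generate G {z} = carrier G"
      then obtain i :: nat where "b = z [^] i" using bc generate_finite[OF fin z(1)] by auto
      then show False using zpow[of i] b by (auto simp: z_def split: if_splits)
    qed
    fix w assume w: "w \<in> carrier G" "w \<noteq> \<one>"
    obtain i s :: nat where s: "s < 2" "w = a [^] i \<otimes> b [^] s" using form w(1) by blast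
    have "\<exists>j::nat. w [^] j = z"
    proof (cases "s = 0")
      case True
      then have wi: "w = a [^] i" using s ac by simp
      then have "i \<noteq> 0" using w(2) by (metis nat_pow_0)
      then obtain u where u: "i = 2 ^ multiplicity 2 i * u" "odd u"
        using multiplicity_decompose'[of i 2] by auto
      define e where "e = multiplicity 2 i"
      \<comment> \<open>\<open>2^e\<close> is the exact power of 2 in \<open>i\<close>; if
        \<open>e\<close> exceeded \<open>l\<close>, then \<open>M\<close> would divide
        \<open>i\<close> and \<open>w\<close> would be trivial. Squaring \<open>l - e\<close> times
        then gives an odd power of \<open>z\<close>.\<close>
      have "e \<le> l"
      proof (rule ccontr)
        assume "\<not> e \<le> l"
        then have "(2::nat) ^ Suc l dvd 2 ^ e" by (intro le_imp_power_dvd) simp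
        then have "M dvd i" using u(1) M unfolding e_def[symmetric] by (metis dvd_mult2 power_Suc)
        then obtain q where "i = M * q" by blast
        then have "w = \<one>" using wi ac aM by (metis nat_pow_pow nat_pow_one)
        then show False using w(2) by blast
      qed
      then have "(2::nat) ^ l = 2 ^ e * 2 ^ (l - e)" by (simp flip: power_add)
      moreover have "i = 2 ^ e * u" using u(1) by (simp add: e_def)
      ultimately have "i * 2 ^ (l - e) = 2 ^ l * u" by simp
      then have "w [^] (2 ^ (l - e) :: nat) = z [^] u"
        using ac unfolding wi z_def zl[symmetric] by (simp add: nat_pow_pow)
      then show ?thesis using zpow[of u] u(2) by auto
    next
      case False
      then have "s = 1" using s(1) by simp
      then have wi: "w = a [^] i \<otimes> b" using s(2) bc by simp
      \<comment> \<open>With twist exponent \<open>M - 1\<close>, standing for -1, the geometric sum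
        is \<open>M\<close>, so the \<open>a\<close>-part of \<open>w^2\<close> vanishes.\<close>
      have "(\<Sum>j<2. (M - 1) ^ j) = M" using M by (simp add: numeral_2_eq_2)
      then have "w [^] (2::nat) = a [^] (i * M) \<otimes> z"
        using twisted_product_pow[OF ac bc quaternion_twist(2)[OF rel], of i 2]
        unfolding wi z_def M_def by simp
      also have "a [^] (i * M) = \<one>" using ac aM by (metis mult.commute nat_pow_pow nat_pow_one)
      finally show ?thesis using z(1) by auto
    qed
    then show "z \<in> generate G {w}" using pow_mem_generate[OF w(1)] by metis
  qed
qed

lemma ex_breaking_point_imp:
  assumes fin: "finite (carrier G)" and "\<exists>C. breaking_point G C"
  shows "(cyclic_group G \<and> (\<exists>p k. prime (p::nat) \<and> order G = p ^ k \<and> p\<^sup>2 \<le> order G)) \<or>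
    is_gen_quaternion G"
proof -
  obtain H where H: "subgroup H G" "H \<noteq> {\<one>}" "H \<noteq> carrier G" "comparable_to_all G H"
    using assms(2) unfolding ex_breaking_point_iff by blast
  obtain p k where p: "prime p" "order G = p ^ k" by (rule comparable_prime_power[OF fin H])
  obtain c where c: "c \<in> carrier G" "ord c = p"
    "\<And>w. w \<in> carrier G \<Longrightarrow> w [^] p = \<one> \<Longrightarrow> w \<in> generate G {c}"
    using comparable_unique_prime_subgroup[OF fin p H] by blast
  obtain j where j: "j \<le> k" "card H = p ^ j" by (rule subgroup_card_prime_power[OF p H(1)])
  have "j \<noteq> 0"
  proof
    assume "j = 0"
    then show False using subgroup_eq_one_iff[OF fin H(1)] H(2) j(2) by simp
  qed
  have "j \<noteq> k"
  proof
    assume "j = k"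
    then have "card (carrier G) = card H" using p(2) j(2) by (simp add: order_def)
    then have "H = carrier G" by (intro card_subset_eq[OF fin subgroup.subset[OF H(1)]]) simp
    then show False using H(3) by blast
  qed
  \<comment> \<open>The exponent satisfies \<open>0 < j < k\<close> because \<open>H\<close> is
    nontrivial and proper, so \<open>k\<close> is at least 2.\<close>
  then have "p ^ 2 \<le> order G" unfolding p(2) using \<open>j \<noteq> 0\<close> j(1) prime_ge_1_nat[OF p(1)]
    by (intro power_increasing) auto
  then show ?thesis
    using unique_prime_subgroup_structure[OF fin p c]
    using is_gen_quaternionI[OF fin] cyclic_group_iff_generate p by metis
qed

end

theorem theorem1:
  fixes G :: "('a, 'b) monoid_scheme"
  assumes "group G" and "finite (carrier G)"
  shows "(\<exists>C. breaking_point G C) \<longleftrightarrow>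
    (cyclic_group G \<and> (\<exists>p k. prime (p::nat) \<and> order G = p ^ k \<and> p\<^sup>2 \<le> order G)) \<or>
    is_gen_quaternion G"
proof -
  interpret group G by fact
  show ?thesis
    using ex_breaking_point_imp[OF assms(2)] cyclic_prime_power_ex_breaking_point[OF assms(2)]
      gen_quaternion_ex_breaking_point[OF assms(2)] by blast
qed

end
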